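(* Let $N\in\mathbb{N}$ be squarefree. Each double coset $\widehat\Gamma_N(\frac1m M)\widehat\Gamma_N$, where $\frac1m M\in\widehat{\mathcal G}_N$ with $m\in\mathbb{N}$ and $M$ integral, contains a unique representative of the form $$\tfrac1m\operatorname{diag}(\alpha,\alpha^*,m,\delta^*,\delta),\qquad \alpha,\alpha^*,\delta,\delta^*\in\mathbb{N},\ \alpha\delta=\alpha^*\delta^*=m^2,\ \alpha\mid\alpha^*\mid m\mid\delta^*\mid\delta.$$ The double coset is uniquely determined by the Smith invariants (elementary divisors) of $M$.
   Context: For matrices $A,B$ of compatible size, $A[B]:=B'AB$ ($'$ = transpose). $S_N=\begin{pmatrix}0&0&1\\0&-2N&0\\1&0&0\end{pmatrix}$, $\widehat S_N=\begin{pmatrix}0&0&1\\0&S_N&0\\1&0&0\end{pmatrix}$ ($5\times5$). $SO(\widehat S_N;\mathbb{R})=\{M\in SL_5(\mathbb{R}):\widehat S_N[M]=\widehat S_N\}$, $SO_0(\widehat S_N;\mathbb{R})$ its identity component, $\widehat\Gamma_N=SO_0(\widehat S_N;\mathbb{R})\cap\mathbb{Z}^{5\times5}$, $\widehat{\mathcal G}_N=SO_0(\widehat S_N;\mathbb{R})\cap\mathbb{Q}^{5\times5}$. *)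

theory Defs
  imports "HOL-Analysis.Analysis" "HOL-Computational_Algebra.Squarefree"
begin

text \<open>
  Rows and columns are numbered by the type \<open>5\<close>, whose elements are \<open>1, 2, 3, 4, 5\<close>
  (with \<open>5 = 0\<close>); \<open>vector [a, b, c, d, e]\<close> has \<open>a\<close> at index \<open>1\<close> and \<open>e\<close> at index \<open>5\<close>.
\<close>

definition transform :: "'a::semiring_1^'n^'n \<Rightarrow> 'a^'k^'n \<Rightarrow> 'a^'k^'k" where
  "transform A B = transpose B ** A ** B"

definition S_mat :: "nat \<Rightarrow> real^3^3" where
  "S_mat N = vector [vector [0, 0, 1],
                     vector [0, - 2 * real N, 0],
                     vector [1, 0, 0]]"

definition S_hat :: "nat \<Rightarrow> real^5^5" where
  "S_hat N = (let S = S_mat N in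
     vector [vector [0, 0, 0, 0, 1],
             vector [0, S $ 1 $ 1, S $ 1 $ 2, S $ 1 $ 3, 0],
             vector [0, S $ 2 $ 1, S $ 2 $ 2, S $ 2 $ 3, 0],
             vector [0, S $ 3 $ 1, S $ 3 $ 2, S $ 3 $ 3, 0],
             vector [1, 0, 0, 0, 0]])"

lemma S_hat_eq:
  "S_hat N = vector [vector [0, 0, 0, 0, 1],
                     vector [0, 0, 0, 1, 0],
                     vector [0, 0, - 2 * real N, 0, 0],
                     vector [0, 1, 0, 0, 0],
                     vector [1, 0, 0, 0, 0]]"
  by (simp add: S_hat_def S_mat_def vector_3)

lemma exhaust_5:
  fixes x :: 5
  shows "x = 1 \<or> x = 2 \<or> x = 3 \<or> x = 4 \<or> x = 5"
proof (induct x)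
  case (of_int z)
  then have "z = 0 \<or> z = 1 \<or> z = 2 \<or> z = 3 \<or> z = 4" by simp arith
  then show ?case by auto
qed

lemma forall_5: "(\<forall>i::5. P i) \<longleftrightarrow> P 1 \<and> P 2 \<and> P 3 \<and> P 4 \<and> P 5"
  by (metis exhaust_5)

lemma vector_5:
  "(vector [a, b, c, d, e] :: 'a::zero^5) $ 1 = a"
  "(vector [a, b, c, d, e] :: 'a::zero^5) $ 2 = b"
  "(vector [a, b, c, d, e] :: 'a::zero^5) $ 3 = c"
  "(vector [a, b, c, d, e] :: 'a::zero^5) $ 4 = d"
  "(vector [a, b, c, d, e] :: 'a::zero^5) $ 5 = e"
  unfolding vector_def by simp_all

definition SO :: "nat \<Rightarrow> (real^5^5) set" where
  "SO N = {M. det M = 1 \<and> transform (S_hat N) M = S_hat N}"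

definition SO0 :: "nat \<Rightarrow> (real^5^5) set" where
  "SO0 N = connected_component_set (SO N) (mat 1)"

definition Gamma_hat :: "nat \<Rightarrow> (real^5^5) set" where
  "Gamma_hat N = SO0 N \<inter> {M. \<forall>i j. M $ i $ j \<in> \<int>}"

definition G_hat :: "nat \<Rightarrow> (real^5^5) set" where
  "G_hat N = SO0 N \<inter> {M. \<forall>i j. M $ i $ j \<in> \<rat>}"

definition double_coset :: "nat \<Rightarrow> real^5^5 \<Rightarrow> (real^5^5) set" where
  "double_coset N g = {x ** g ** y | x y. x \<in> Gamma_hat N \<and> y \<in> Gamma_hat N}"

definition over_m :: "nat \<Rightarrow> int^5^5 \<Rightarrow> real^5^5" where
  "over_m m M = (1 / real m) *\<^sub>R map_matrix real_of_int M"

definition diag_mat :: "nat^5 \<Rightarrow> int^5^5" where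
  "diag_mat d = (\<chi> i j. if i = j then int (d $ i) else 0)"

definition elementary_rep :: "nat \<Rightarrow> real^5^5 \<Rightarrow> bool" where
  "elementary_rep m D \<longleftrightarrow>
     (\<exists>\<alpha> \<alpha>' \<delta>' \<delta> :: nat.
        0 < \<alpha> \<and> 0 < \<alpha>' \<and> 0 < \<delta>' \<and> 0 < \<delta> \<and>
        \<alpha> * \<delta> = m\<^sup>2 \<and> \<alpha>' * \<delta>' = m\<^sup>2 \<and>
        \<alpha> dvd \<alpha>' \<and> \<alpha>' dvd m \<and> m dvd \<delta>' \<and> \<delta>' dvd \<delta> \<and>
        D = over_m m (diag_mat (vector [\<alpha>, \<alpha>', m, \<delta>', \<delta>])))"

text \<open>Over the integers, \<open>invertible\<close> describes membership in \<open>GL\<^sub>5(\<int>)\<close>.\<close>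

definition smith_normal_form :: "int^5^5 \<Rightarrow> nat^5 \<Rightarrow> bool" where
  "smith_normal_form M d \<longleftrightarrow>
     (\<exists>U V. invertible U \<and> invertible V \<and> U ** M ** V = diag_mat d) \<and>
     d $ 1 dvd d $ 2 \<and> d $ 2 dvd d $ 3 \<and> d $ 3 dvd d $ 4 \<and> d $ 4 dvd d $ 5"

definition smith_invariants :: "int^5^5 \<Rightarrow> nat^5" where
  "smith_invariants M = (THE d. smith_normal_form M d)"

end

theory Submission
  imports Defs
begin

text \<open>
  Let \<open>q(v) = v\<^sub>1 v\<^sub>5 + v\<^sub>2 v\<^sub>4 - N v\<^sub>3\<^sup>2\<close>. Since \<open>N\<close> is squarefree, the lattice \<open>\<int>\<^sup>5\<close> is maximal: a vector of the dual lattice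
  with integral \<open>q\<close> is integral. Hence \<open>S\<inverse> M' S\<close> is integral with \<open>M\<close>, and every nonzero isotropic
  vector can be moved by the group to a multiple of \<open>e\<^sub>1\<close>. In the double coset of \<open>M\<close> choose a matrix whose
  nonzero \<open>(1, 1)\<close> entry \<open>c\<close> has minimal absolute value; then \<open>c\<close> divides the first row and column, which can be cleared,
  and comparing with \<open>M\<close> applied to the isotropic vectors \<open>e\<^sub>1 + e\<^sub>2\<close>, \<open>e\<^sub>1 - e\<^sub>4\<close>, \<open>e\<^sub>1 + e\<^sub>3 + N e\<^sub>5\<close> shows that
  \<open>c\<close> divides all entries. The same argument applies to the remaining \<open>3 \<times> 3\<close> block, where Atkin--Lehner
  elements provide the transitivity on isotropic lines. Signs are controlled by the action of the identity
  component on a maximal positive definite subspace, and uniqueness is that of the Smith normal form.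
\<close>

section \<open>The orthogonal group and its identity component\<close>

text \<open>Membership in \<open>SO0 N\<close> is always obtained from an explicit path to the
  identity. The swaps and the Atkin--Lehner elements are therefore factored into unipotents and a
  torus element with positive parameter, even where the factors are only real. The ternary form
  \<open>x2 * x4 - N * x3^2\<close> is the obstacle in the second reduction. The maps
  \<open>eichler2\<close> and \<open>eichler4\<close> change \<open>x2\<close> only by multiples of
  \<open>N\<close>, so on primitive isotropic vectors they preserve \<open>gcd x2 N\<close>; there
  is one family of lines for each way of writing \<open>N = a * b\<close>, just as
  \<open>Gamma_0(N)\<close> has one cusp per divisor of a squarefree \<open>N\<close>. The
  Atkin--Lehner elements merge these families. In five variables this does not arise: the second
  hyperbolic plane supplies row and column operations that run the Euclidean algorithm. Both
  reductions treat rows like columns. A row belongs to the dual lattice, and the squarefree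
  hypothesis makes its preimage under the Gram matrix an integral isotropic vector, so one orbit
  theorem serves both sides. The denominator is not lost in the Smith invariants, because
  \<open>m\<close> is itself the third of them.\<close>

lemma sum_UNIV_5: "sum f (UNIV :: 5 set) = f 1 + f 2 + f 3 + f 4 + f 5"
proof -
  have U: "(UNIV :: 5 set) = {1, 2, 3, 4, 5}"
    using exhaust_5 by auto
  show ?thesis
    unfolding U by (simp add: add.assoc)
qed

lemmas matrix_5_simps =
  vec_eq_iff forall_5 sum_UNIV_5 vector_5 matrix_matrix_mult_def matrix_vector_mult_def
  transpose_def mat_def

text \<open>The Gram matrix over any commutative ring: the same identities are needed over
  \<open>real\<close> for paths and over \<open>int\<close> for divisibility.\<close>

definition form_mat :: "nat \<Rightarrow> 'a::comm_ring_1^5^5" where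
  "form_mat N = vector [vector [0, 0, 0, 0, 1],
                        vector [0, 0, 0, 1, 0],
                        vector [0, 0, - 2 * of_nat N, 0, 0],
                        vector [0, 1, 0, 0, 0],
                        vector [1, 0, 0, 0, 0]]"

lemma S_hat_form_mat: "S_hat N = form_mat N"
  by (simp add: S_hat_eq form_mat_def)

definition isotropic :: "nat \<Rightarrow> int^5 \<Rightarrow> bool" where
  "isotropic N u \<longleftrightarrow> u$1 * u$5 + u$2 * u$4 = int N * (u$3)\<^sup>2"

text \<open>The right-hand side is the polar form of \<open>q\<close> at columns \<open>i\<close>
  and \<open>j\<close>; on the diagonal it is twice \<open>q\<close>.\<close>

lemma transform_form_mat:
  fixes M :: "'a::comm_ring_1^5^5"
  shows "transform (form_mat N) M $ i $ j =
    M$1$i * M$5$j + M$5$i * M$1$j + M$2$i * M$4$j + M$4$i * M$2$j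
      - 2 * of_nat N * M$3$i * M$3$j"
  by (simp add: transform_def matrix_5_simps form_mat_def algebra_simps)

lemma transform_mult:
  fixes A :: "'a::comm_ring_1^'n^'n"
  shows "transform A (B ** C) = transform (transform A B) C"
  by (simp add: transform_def matrix_transpose_mul matrix_mul_assoc)

abbreviation real_matrix :: "int^5^5 \<Rightarrow> real^5^5" where
  "real_matrix A \<equiv> map_matrix real_of_int A"

lemma real_matrix_nth: "real_matrix A $ i $ j = real_of_int (A $ i $ j)"
  by (simp add: map_matrix_def)

lemma real_matrix_mult: "real_matrix (A ** B) = real_matrix A ** real_matrix B"
  by (simp add: vec_eq_iff real_matrix_nth matrix_matrix_mult_def)

lemma real_matrix_one: "real_matrix (mat 1) = mat 1"
  by (simp add: vec_eq_iff real_matrix_nth mat_def)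

lemma real_matrix_inject: "real_matrix A = real_matrix B \<longleftrightarrow> A = B"
  by (simp add: vec_eq_iff real_matrix_nth)

lemma real_matrix_transform:
  "real_matrix (transform (form_mat N) A) = transform (form_mat N) (real_matrix A)"
  by (simp add: vec_eq_iff transform_form_mat real_matrix_nth)

lemma continuous_on_matrix:
  fixes f :: "'a::topological_space \<Rightarrow> real^'n^'m"
  assumes "\<forall>i j. continuous_on S (\<lambda>x. f x $ i $ j)"
  shows "continuous_on S f"
proof -
  have "continuous_on S (\<lambda>x. \<chi> i. \<chi> j. f x $ i $ j)"
    using assms by (intro continuous_on_vec_lambda) auto
  then show ?thesis by simp
qed

lemma continuous_on_det:
  fixes f :: "'a::topological_space \<Rightarrow> real^'n^'n"
  assumes "continuous_on S f"
  shows "continuous_on S (\<lambda>x. det (f x))"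
  unfolding det_def by (intro continuous_intros assms)

lemma continuous_on_matrix_mult:
  fixes f :: "'a::topological_space \<Rightarrow> real^'n^'m" and g :: "'a \<Rightarrow> real^'k^'n"
  assumes "continuous_on S f" "continuous_on S g"
  shows "continuous_on S (\<lambda>x. f x ** g x)"
  by (intro continuous_on_matrix allI) (simp add: matrix_matrix_mult_def, intro continuous_intros assms)

lemma det_form_mat_nonzero:
  assumes "N > 0" shows "det (form_mat N :: real^5^5) \<noteq> 0"
proof -
  define B :: "real^5^5" where "B = vector [vector [0, 0, 0, 0, 1],
                        vector [0, 0, 0, 1, 0],
                        vector [0, 0, - 1 / (2 * of_nat N), 0, 0],
                        vector [0, 1, 0, 0, 0],
                        vector [1, 0, 0, 0, 0]]"
  have "form_mat N ** B = mat 1"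
    using assms by (simp add: form_mat_def B_def matrix_5_simps)
  then have "det (form_mat N :: real^5^5) * det B = 1"
    by (metis det_I det_mul)
  then show ?thesis by auto
qed

lemma SO_iff: "M \<in> SO N \<longleftrightarrow> det M = 1 \<and> transform (form_mat N) M = form_mat N"
  by (simp add: SO_def S_hat_form_mat)

lemma SO0_subset_SO: "SO0 N \<subseteq> SO N"
  by (simp add: SO0_def connected_component_subset)

lemma one_in_SO: "mat 1 \<in> SO N"
  by (simp add: SO_iff transform_def transpose_mat)

lemma one_in_SO0: "mat 1 \<in> SO0 N"
  by (simp add: SO0_def one_in_SO)

lemma SO_mult: "x \<in> SO N \<Longrightarrow> y \<in> SO N \<Longrightarrow> x ** y \<in> SO N"
  by (simp add: SO_iff det_mul transform_mult)

lemma SO_left_inverse: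
  assumes "x \<in> SO N" "y ** x = mat 1"
  shows "y \<in> SO N"
proof -
  have "det y * det x = 1" by (metis assms(2) det_I det_mul)
  moreover have "transform (form_mat N) y = form_mat N"
  proof -
    have "x ** y = mat 1" using assms(2) matrix_left_right_inverse by blast
    then have "transform (transform (form_mat N) x) y = form_mat N"
      by (subst transform_mult[symmetric]) (simp add: transform_def transpose_mat)
    then show ?thesis using assms(1) by (simp add: SO_iff)
  qed
  ultimately show ?thesis using assms(1) by (simp add: SO_iff)
qed

lemma SO0_maximal:
  "connected C \<Longrightarrow> C \<subseteq> SO N \<Longrightarrow> x \<in> C \<Longrightarrow> x \<in> SO0 N \<Longrightarrow> C \<subseteq> SO0 N"
  unfolding SO0_def
  by (metis connected_component_eq connected_component_maximal)

lemma connected_SO0: "connected (SO0 N)"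
  by (simp add: SO0_def)

lemma connected_left_translate:
  fixes C :: "(real^5^5) set"
  shows "connected C \<Longrightarrow> connected ((\<lambda>y. x ** y) ` C)"
  by (intro connected_continuous_image continuous_on_matrix_mult continuous_intros)

text \<open>Left translation by \<open>x\<close> carries the component to a connected subset of
  \<open>SO N\<close> that meets the component in \<open>x\<close>.\<close>

lemma SO0_mult:
  assumes "x \<in> SO0 N" "y \<in> SO0 N"
  shows "x ** y \<in> SO0 N"
proof -
  have "(\<lambda>y. x ** y) ` SO0 N \<subseteq> SO0 N"
  proof (rule SO0_maximal)
    show "(\<lambda>y. x ** y) ` SO0 N \<subseteq> SO N"
      using assms SO_mult SO0_subset_SO by blast
    show "x \<in> (\<lambda>y. x ** y) ` SO0 N"
      using one_in_SO0[of N] by (metis imageI matrix_mul_rid)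
  qed (use assms connected_left_translate connected_SO0 in auto)
  with assms show ?thesis by auto
qed

text \<open>The translate of the component by \<open>y\<close> contains
  \<open>y ** x = mat 1\<close>, so it stays in the component; it also contains
  \<open>y\<close>.\<close>

lemma SO0_left_inverse:
  assumes "x \<in> SO0 N" "y ** x = mat 1"
  shows "y \<in> SO0 N"
proof -
  have "(\<lambda>z. y ** z) ` SO0 N \<subseteq> SO0 N"
  proof (rule SO0_maximal)
    show "(\<lambda>z. y ** z) ` SO0 N \<subseteq> SO N"
      using assms SO_mult SO0_subset_SO SO_left_inverse by blast
    show "mat 1 \<in> (\<lambda>z. y ** z) ` SO0 N"
      using assms by (metis imageI)
  qed (auto simp: connected_left_translate connected_SO0 one_in_SO0)
  then show ?thesis using one_in_SO0[of N] by (metis image_subset_iff matrix_mul_rid)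
qed

text \<open>Form preservation forces \<open>det = \<plusminus>1\<close>, so along a path from the identity the determinant
  stays \<open>1\<close>.\<close>

lemma SO0_pathI:
  fixes f :: "real \<Rightarrow> real^5^5"
  assumes N: "N > 0" and f: "continuous_on {0..1} f" "f 0 = mat 1"
    and form: "\<And>t. t \<in> {0..1} \<Longrightarrow> transform (form_mat N) (f t) = form_mat N"
  shows "f 1 \<in> SO0 N"
proof -
  have sq: "det (f t) = 1 \<or> det (f t) = -1" if "t \<in> {0..1}" for t
  proof -
    have "det (f t) * det (form_mat N :: real^5^5) * det (f t) = det (form_mat N :: real^5^5)"
      using form[OF that] by (metis transform_def det_mul det_transpose)
    then have "(det (f t))\<^sup>2 = 1"
      using det_form_mat_nonzero[OF N] by (simp add: power2_eq_square)
    then show ?thesis by (simp add: power2_eq_1_iff)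
  qed
  have c: "continuous_on {0..1} (\<lambda>t. det (f t))"
    by (intro continuous_on_det f)
  have d1: "det (f t) = 1" if "t \<in> {0..1}" for t
  proof (rule ccontr)
    assume "det (f t) \<noteq> 1"
    then have "det (f t) = -1" using sq[OF that] by simp
    then have "\<exists>x\<ge>0. x \<le> t \<and> det (f x) = 0"
      using that f(2) continuous_on_subset[OF c, of "{0..t}"]
      by (intro IVT2') auto
    then show False using sq that by fastforce
  qed
  have "f ` {0..1} \<subseteq> SO0 N"
  proof (rule SO0_maximal)
    show "connected (f ` {0..1})" by (intro connected_continuous_image f) simp
    show "f ` {0..1} \<subseteq> SO N" using d1 form by (auto simp: SO_iff)
    show "mat 1 \<in> f ` {0..1}" using f(2) by force
  qed (rule one_in_SO0)
  then show ?thesis by auto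
qed

section \<open>Integral elements of the group\<close>

lemma form_mat_nth:
  "form_mat N $ 1 $ 1 = 0" "form_mat N $ 1 $ 2 = 0" "form_mat N $ 1 $ 3 = 0" "form_mat N $ 1 $ 4 = 0" "form_mat N $ 1 $ 5 = 1"
  "form_mat N $ 2 $ 1 = 0" "form_mat N $ 2 $ 2 = 0" "form_mat N $ 2 $ 3 = 0" "form_mat N $ 2 $ 4 = 1" "form_mat N $ 2 $ 5 = 0"
  "form_mat N $ 3 $ 1 = 0" "form_mat N $ 3 $ 2 = 0" "form_mat N $ 3 $ 3 = - 2 * of_nat N" "form_mat N $ 3 $ 4 = 0" "form_mat N $ 3 $ 5 = 0"
  "form_mat N $ 4 $ 1 = 0" "form_mat N $ 4 $ 2 = 1" "form_mat N $ 4 $ 3 = 0" "form_mat N $ 4 $ 4 = 0" "form_mat N $ 4 $ 5 = 0"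
  "form_mat N $ 5 $ 1 = 1" "form_mat N $ 5 $ 2 = 0" "form_mat N $ 5 $ 3 = 0" "form_mat N $ 5 $ 4 = 0" "form_mat N $ 5 $ 5 = 0"
  by (simp_all add: form_mat_def vector_5)

text \<open>The integral group with entries of type \<open>int\<close>, so that divisibility and
  minimality arguments apply directly; \<open>Gamma_hat_iff\<close> translates back.\<close>

definition Gamma_int :: "nat \<Rightarrow> (int^5^5) set" where
  "Gamma_int N = {A. real_matrix A \<in> SO0 N}"

lemma Gamma_int_one: "mat 1 \<in> Gamma_int N"
  by (simp add: Gamma_int_def real_matrix_one one_in_SO0)

lemma Gamma_int_mult: "A \<in> Gamma_int N \<Longrightarrow> B \<in> Gamma_int N \<Longrightarrow> A ** B \<in> Gamma_int N"
  by (simp add: Gamma_int_def real_matrix_mult SO0_mult)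

lemma Gamma_int_form:
  assumes "A \<in> Gamma_int N"
  shows "transform (form_mat N) A = form_mat N"
proof -
  have "transform (form_mat N) (real_matrix A) = form_mat N"
    using assms SO0_subset_SO[of N] by (auto simp: Gamma_int_def SO_iff)
  moreover have "form_mat N = real_matrix (form_mat N)"
    by (simp add: vec_eq_iff forall_5 real_matrix_nth form_mat_def vector_5)
  ultimately show ?thesis
    by (metis real_matrix_transform real_matrix_inject)
qed

text \<open>Writing the coordinates \<open>1, 2, 4, 5\<close> as the matrix \<open>((v\<^sub>1, v\<^sub>2), (-v\<^sub>4, v\<^sub>5))\<close>, whose determinant
  is \<open>v\<^sub>1 v\<^sub>5 + v\<^sub>2 v\<^sub>4\<close>, these are the elementary row and column operations.\<close>

definition row_upper :: "'a::comm_ring_1 \<Rightarrow> 'a^5^5" where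
  "row_upper t = vector [vector [1, 0, 0, -t, 0], vector [0, 1, 0, 0, t], vector [0, 0, 1, 0, 0],
     vector [0, 0, 0, 1, 0], vector [0, 0, 0, 0, 1]]"

definition row_lower :: "'a::comm_ring_1 \<Rightarrow> 'a^5^5" where
  "row_lower t = vector [vector [1, 0, 0, 0, 0], vector [0, 1, 0, 0, 0], vector [0, 0, 1, 0, 0],
     vector [-t, 0, 0, 1, 0], vector [0, t, 0, 0, 1]]"

definition col_upper :: "'a::comm_ring_1 \<Rightarrow> 'a^5^5" where
  "col_upper t = vector [vector [1, 0, 0, 0, 0], vector [t, 1, 0, 0, 0], vector [0, 0, 1, 0, 0],
     vector [0, 0, 0, 1, 0], vector [0, 0, 0, -t, 1]]"

definition col_lower :: "'a::comm_ring_1 \<Rightarrow> 'a^5^5" where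
  "col_lower t = vector [vector [1, t, 0, 0, 0], vector [0, 1, 0, 0, 0], vector [0, 0, 1, 0, 0],
     vector [0, 0, 0, 1, -t], vector [0, 0, 0, 0, 1]]"

text \<open>Eichler transvections along \<open>e\<^sub>5\<close>, \<open>e\<^sub>4\<close> and \<open>e\<^sub>2\<close> with respect to the anisotropic vector \<open>e\<^sub>3\<close>.\<close>

definition eichler5 :: "nat \<Rightarrow> 'a::comm_ring_1 \<Rightarrow> 'a^5^5" where
  "eichler5 N t = vector [vector [1, 0, 0, 0, 0], vector [0, 1, 0, 0, 0], vector [t, 0, 1, 0, 0],
     vector [0, 0, 0, 1, 0], vector [of_nat N * t * t, 0, 2 * of_nat N * t, 0, 1]]"

definition eichler4 :: "nat \<Rightarrow> 'a::comm_ring_1 \<Rightarrow> 'a^5^5" where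
  "eichler4 N t = vector [vector [1, 0, 0, 0, 0], vector [0, 1, 0, 0, 0], vector [0, t, 1, 0, 0],
     vector [0, of_nat N * t * t, 2 * of_nat N * t, 1, 0], vector [0, 0, 0, 0, 1]]"

definition eichler2 :: "nat \<Rightarrow> 'a::comm_ring_1 \<Rightarrow> 'a^5^5" where
  "eichler2 N t = vector [vector [1, 0, 0, 0, 0], vector [0, 1, 2 * of_nat N * t, of_nat N * t * t, 0],
     vector [0, 0, 1, t, 0], vector [0, 0, 0, 1, 0], vector [0, 0, 0, 0, 1]]"

lemmas generator_defs = row_upper_def row_lower_def col_upper_def col_lower_def
  eichler5_def eichler4_def eichler2_def

lemma real_matrix_generators:
  "real_matrix (row_upper t) = row_upper (real_of_int t)"
  "real_matrix (row_lower t) = row_lower (real_of_int t)"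
  "real_matrix (col_upper t) = col_upper (real_of_int t)"
  "real_matrix (col_lower t) = col_lower (real_of_int t)"
  "real_matrix (eichler5 N t) = eichler5 N (real_of_int t)"
  "real_matrix (eichler4 N t) = eichler4 N (real_of_int t)"
  "real_matrix (eichler2 N t) = eichler2 N (real_of_int t)"
  by (simp_all add: generator_defs vec_eq_iff forall_5 real_matrix_nth vector_5)

text \<open>Each matrix is polynomial in its parameter and an isometry for every real value, so
  shrinking \<open>t\<close> to 0 joins it to the identity.\<close>

lemma generators_SO0:
  fixes t :: real
  assumes "N > 0"
  shows "row_upper t \<in> SO0 N" "row_lower t \<in> SO0 N" "col_upper t \<in> SO0 N"
    "col_lower t \<in> SO0 N" "eichler5 N t \<in> SO0 N" "eichler4 N t \<in> SO0 N" "eichler2 N t \<in> SO0 N"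
proof -
  have *: "g t \<in> SO0 N"
    if "continuous_on {0..1} (\<lambda>s. g (s * t))" "g 0 = mat 1"
      "\<And>s. transform (form_mat N) (g s) = form_mat N" for g :: "real \<Rightarrow> real^5^5"
    using SO0_pathI[OF assms, of "\<lambda>s. g (s * t)"] that by simp
  note s = generator_defs vec_eq_iff forall_5 vector_5 mat_def transform_form_mat form_mat_nth
  show "row_upper t \<in> SO0 N"
    by (rule *, rule continuous_on_matrix) (auto simp: s intro!: continuous_intros)
  show "row_lower t \<in> SO0 N"
    by (rule *, rule continuous_on_matrix) (auto simp: s intro!: continuous_intros)
  show "col_upper t \<in> SO0 N"
    by (rule *, rule continuous_on_matrix) (auto simp: s intro!: continuous_intros)
  show "col_lower t \<in> SO0 N"
    by (rule *, rule continuous_on_matrix) (auto simp: s intro!: continuous_intros)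
  show "eichler5 N t \<in> SO0 N"
    by (rule *, rule continuous_on_matrix) (auto simp: s intro!: continuous_intros)
  show "eichler4 N t \<in> SO0 N"
    by (rule *, rule continuous_on_matrix) (auto simp: s intro!: continuous_intros)
  show "eichler2 N t \<in> SO0 N"
    by (rule *, rule continuous_on_matrix) (auto simp: s intro!: continuous_intros)
qed

lemma generators_Gamma_int:
  assumes "N > 0"
  shows "row_upper t \<in> Gamma_int N" "row_lower t \<in> Gamma_int N" "col_upper t \<in> Gamma_int N"
    "col_lower t \<in> Gamma_int N" "eichler5 N t \<in> Gamma_int N" "eichler4 N t \<in> Gamma_int N"
    "eichler2 N t \<in> Gamma_int N"
  using generators_SO0[OF assms] by (simp_all add: Gamma_int_def real_matrix_generators)

definition torus :: "real \<Rightarrow> real^5^5" where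
  "torus s = vector [vector [1, 0, 0, 0, 0], vector [0, s, 0, 0, 0], vector [0, 0, 1, 0, 0],
     vector [0, 0, 0, 1 / s, 0], vector [0, 0, 0, 0, 1]]"

text \<open>The segment from 1 to \<open>s\<close> avoids 0, which keeps the entry
  \<open>1 / s\<close> continuous along the path.\<close>

lemma torus_SO0:
  assumes "N > 0" "s > 0"
  shows "torus s \<in> SO0 N"
proof -
  have p: "1 + t * (s - 1) > 0" if "t \<in> {0..1}" for t
  proof -
    have "(1 - t) + t * s > 0"
      using that assms(2) by (cases "t = 1") (auto intro: add_pos_nonneg)
    then show ?thesis by (simp add: algebra_simps)
  qed
  have "torus (1 + 1 * (s - 1)) \<in> SO0 N"
  proof (rule SO0_pathI[OF assms(1), of "\<lambda>t. torus (1 + t * (s - 1))"])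
    have "\<forall>t\<in>{0..1}. 1 + t * (s - 1) \<noteq> 0" using p by force
    then show "continuous_on {0..1} (\<lambda>t. torus (1 + t * (s - 1)))"
      by (intro continuous_on_matrix) (auto simp: torus_def forall_5 vector_5 intro!: continuous_intros)
    show "torus (1 + 0 * (s - 1)) = mat 1"
      by (simp add: torus_def vec_eq_iff forall_5 vector_5 mat_def)
    show "transform (form_mat N) (torus (1 + t * (s - 1))) = form_mat N" if "t \<in> {0..1}" for t
      using p[OF that] by (simp add: torus_def vec_eq_iff forall_5 vector_5 transform_form_mat form_mat_nth)
  qed
  then show ?thesis by simp
qed

text \<open>Left and right multiplication by \<open>((0, 1), (-1, 0))\<close>.\<close>

definition row_swap :: "int^5^5" where
  "row_swap = vector [vector [0, 0, 0, -1, 0], vector [0, 0, 0, 0, 1], vector [0, 0, 1, 0, 0],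
     vector [1, 0, 0, 0, 0], vector [0, -1, 0, 0, 0]]"

definition col_swap :: "int^5^5" where
  "col_swap = vector [vector [0, -1, 0, 0, 0], vector [1, 0, 0, 0, 0], vector [0, 0, 1, 0, 0],
     vector [0, 0, 0, 0, 1], vector [0, 0, 0, -1, 0]]"

text \<open>The Weyl element of \<open>SL2\<close> is a product of three elementary matrices (upper,
  lower, upper).\<close>

lemma swaps_Gamma_int:
  assumes "N > 0"
  shows "row_swap \<in> Gamma_int N" "col_swap \<in> Gamma_int N"
proof -
  have "row_swap = row_upper 1 ** row_lower (-1) ** row_upper 1"
    by (simp add: row_swap_def row_upper_def row_lower_def matrix_5_simps)
  also have "\<dots> \<in> Gamma_int N"
    by (intro Gamma_int_mult generators_Gamma_int assms)
  finally show "row_swap \<in> Gamma_int N" .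
  have "col_swap = col_upper 1 ** col_lower (-1) ** col_upper 1"
    by (simp add: col_swap_def col_upper_def col_lower_def matrix_5_simps)
  also have "\<dots> \<in> Gamma_int N"
    by (intro Gamma_int_mult generators_Gamma_int assms)
  finally show "col_swap \<in> Gamma_int N" .
qed

text \<open>The Atkin--Lehner type elements of the stabiliser of \<open>e\<^sub>1\<close> and \<open>e\<^sub>5\<close>: identify \<open>(x\<^sub>2, x\<^sub>3, x\<^sub>4)\<close> with
  \<open>X = ((x\<^sub>2, N x\<^sub>3), (N x\<^sub>3, N x\<^sub>4))\<close> and let \<open>P = ((a s, l), (N r, a w))\<close>, of determinant \<open>a\<close>, act by
  \<open>X \<mapsto> P X P' / a\<close>.\<close>

definition atkin_lehner :: "'a::comm_ring_1 \<Rightarrow> 'a \<Rightarrow> 'a \<Rightarrow> 'a \<Rightarrow> 'a \<Rightarrow> 'a \<Rightarrow> 'a^5^5" where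
  "atkin_lehner a b s l r w = vector [vector [1, 0, 0, 0, 0],
     vector [0, a * s * s, 2 * a * b * s * l, b * l * l, 0],
     vector [0, s * r, a * s * w + b * l * r, l * w, 0],
     vector [0, b * r * r, 2 * a * b * r * w, a * w * w, 0],
     vector [0, 0, 0, 0, 1]]"

lemma atkin_lehner_Gamma_int:
  fixes a b s l r w :: int
  assumes "N > 0" "a > 0" "s \<noteq> 0" and N: "int N = a * b" and det: "a * s * w - b * l * r = 1"
  shows "atkin_lehner a b s l r w \<in> Gamma_int N"
proof -
  define A B S L R W where d: "A = real_of_int a" "B = real_of_int b" "S = real_of_int s"
    "L = real_of_int l" "R = real_of_int r" "W = real_of_int w"
  have nz: "A \<noteq> 0" "S \<noteq> 0" using assms(2,3) by (auto simp: d)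
  have NAB: "real N = A * B"
    using arg_cong[OF N, of real_of_int] by (simp add: d)
  have W: "W = (1 + B * L * R) / (A * S)"
    using arg_cong[OF det, of real_of_int] nz by (simp add: d field_simps)
  have "real_matrix (atkin_lehner a b s l r w) = atkin_lehner A B S L R W"
    by (simp add: atkin_lehner_def vec_eq_iff forall_5 real_matrix_nth vector_5 d)
  \<comment> \<open>Lower-diagonal-upper factorisation of \<open>P\<close> with pivot
    \<open>A * S\<close>. The factors need not be integral; the torus parameter is the square of the
    pivot divided by the determinant \<open>A\<close>, hence positive.\<close>
  also have "\<dots> = eichler4 N (R / (A * S)) ** torus (A * S * S) ** eichler2 N (L / (A * S))"
    using nz by (simp add: atkin_lehner_def eichler4_def eichler2_def torus_def matrix_5_simps NAB W
        field_simps)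
  also have "\<dots> \<in> SO0 N"
  proof (intro SO0_mult generators_SO0 torus_SO0 assms)
    show "A * S * S > 0"
      using assms(2,3) by (auto simp: d mult.assoc zero_less_mult_iff)
  qed
  finally show ?thesis by (simp add: Gamma_int_def)
qed

section \<open>Integrality of the adjoint\<close>

lemma squarefree_nat_pos: "squarefree (N :: nat) \<Longrightarrow> N > 0"
  by (rule ccontr) simp

text \<open>After cancelling the gcd, the square of the cofactor of \<open>c\<close> divides the
  squarefree \<open>N\<close>, so the cofactor is a unit. This is the arithmetic form of the
  maximality of the lattice.\<close>

lemma squarefree_square_dvd:
  fixes c x :: int
  assumes "squarefree N" "c\<^sup>2 dvd int N * x\<^sup>2"
  shows "c dvd x"
proof (cases "gcd c x = 0")
  case False
  then obtain c1 x1 where cx: "c = c1 * gcd c x" "x = x1 * gcd c x" "coprime c1 x1"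
    using gcd_coprime_exists by blast
  define g where "g = gcd c x"
  have "g\<^sup>2 * c1\<^sup>2 dvd g\<^sup>2 * (int N * x1\<^sup>2)"
    using assms(2) cx(1,2) unfolding g_def[symmetric] by (metis power_mult_distrib mult.commute mult.left_commute)
  then have "c1\<^sup>2 dvd int N * x1\<^sup>2"
    using False by (auto simp: g_def)
  then have "c1\<^sup>2 dvd int N"
    using cx(3) by (simp add: coprime_dvd_mult_left_iff)
  then have "(nat \<bar>c1\<bar>)\<^sup>2 dvd N"
    by (metis int_dvd_int_iff nat_0_le abs_ge_zero of_nat_power power2_abs)
  then have "nat \<bar>c1\<bar> dvd 1" using assms(1) squarefreeD by blast
  then have "c1 dvd 1" by (simp add: nat_abs_dvd_iff)
  then show ?thesis using cx(1,2) by (metis dvd_triv_right dvd_trans gcd_dvd2 mult_unit_dvd_iff')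
qed simp

lemma squarefree_dvd_of_square:
  fixes r k :: int
  assumes "squarefree N" "r\<^sup>2 = 4 * int N * k"
  shows "2 * int N dvd r"
proof -
  have "even (r\<^sup>2)" using assms(2) by simp
  then obtain e where e: "r = 2 * e" by auto
  then have "e\<^sup>2 = int N * k" using assms(2) by (simp add: power_mult_distrib)
  then have "(int N)\<^sup>2 dvd int N * e\<^sup>2" by (metis dvd_triv_left mult.assoc power2_eq_square)
  then have "int N dvd e" by (rule squarefree_square_dvd[OF assms(1)])
  then show ?thesis unfolding e by (rule mult_dvd_mono[OF dvd_refl])
qed

lemma scaleR_matrix:
  fixes A B :: "real^'n^'n"
  shows "(c *\<^sub>R A) ** B = c *\<^sub>R (A ** B)" "A ** (c *\<^sub>R B) = c *\<^sub>R (A ** B)"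
  by (simp_all add: vec_eq_iff matrix_matrix_mult_def sum_distrib_left algebra_simps)

lemma over_m_mult: "over_m m (A ** M ** B) = real_matrix A ** over_m m M ** real_matrix B"
  by (simp add: over_m_def real_matrix_mult scaleR_matrix)

lemma over_m_form:
  assumes "m > 0" "over_m m M \<in> SO N"
  shows "transform (form_mat N) M $ i $ j = (int m)\<^sup>2 * form_mat N $ i $ j"
proof -
  have "transform (form_mat N) (over_m m M) $ i $ j = (1 / real m)\<^sup>2 * transform (form_mat N) (real_matrix M) $ i $ j"
    by (simp add: transform_form_mat over_m_def algebra_simps power2_eq_square add_divide_distrib)
  then have "transform (form_mat N) (real_matrix M) $ i $ j = (real m)\<^sup>2 * form_mat N $ i $ j"
    using assms by (simp add: SO_iff field_simps)
  also have "transform (form_mat N) (real_matrix M) $ i $ j = real_of_int (transform (form_mat N) M $ i $ j)"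
    by (simp add: real_matrix_nth flip: real_matrix_transform)
  also have "form_mat N $ i $ j = real_of_int (form_mat N $ i $ j)"
    using exhaust_5[of i] exhaust_5[of j] by (auto simp: form_mat_nth)
  finally have "real_of_int (transform (form_mat N) M $ i $ j) = real_of_int ((int m)\<^sup>2 * form_mat N $ i $ j)"
    by simp
  then show ?thesis by (simp only: of_int_eq_iff)
qed

text \<open>\<open>S\<inverse> M' S\<close>; its third row is a genuine quotient by \<open>third_column_dvd\<close>.\<close>

definition adjoint_mat :: "nat \<Rightarrow> int^5^5 \<Rightarrow> int^5^5" where
  "adjoint_mat N M = (let n = 2 * int N in vector
    [vector [M$5$5, M$4$5, - n * M$3$5, M$2$5, M$1$5],
     vector [M$5$4, M$4$4, - n * M$3$4, M$2$4, M$1$4],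
     vector [- (M$5$3 div n), - (M$4$3 div n), M$3$3, - (M$2$3 div n), - (M$1$3 div n)],
     vector [M$5$2, M$4$2, - n * M$3$2, M$2$2, M$1$2],
     vector [M$5$1, M$4$1, - n * M$3$1, M$2$1, M$1$1]])"

text \<open>Inverting turns the relations between columns into relations between rows: each row
  other than the third is isotropic for the inverse form. Clearing denominators gives
  \<open>row_form\<close>, squarefreeness gives \<open>third_column_dvd\<close>, and this makes the
  adjoint integral.\<close>

lemma
  assumes sf: "squarefree N" and m: "m > 0" "over_m m M \<in> SO N"
  shows third_column_dvd: "i \<noteq> 3 \<Longrightarrow> 2 * int N dvd M$i$3"
    and row_form: "i \<noteq> 3 \<Longrightarrow> (M$i$3)\<^sup>2 = 4 * int N * (M$i$1 * M$i$5 + M$i$2 * M$i$4)"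
    and adjoint_mat_left: "adjoint_mat N M ** M = mat ((int m)\<^sup>2)"
    and adjoint_mat_right: "M ** adjoint_mat N M = mat ((int m)\<^sup>2)"
proof -
  have N: "N > 0" by (rule squarefree_nat_pos[OF sf])
  define n where "n = 2 * real N"
  have n: "n \<noteq> 0" using N by (simp add: n_def)
  define X where "X = over_m m M"
  define Y :: "real^5^5" where "Y = vector
    [vector [X$5$5, X$4$5, - n * X$3$5, X$2$5, X$1$5],
     vector [X$5$4, X$4$4, - n * X$3$4, X$2$4, X$1$4],
     vector [- (X$5$3 / n), - (X$4$3 / n), X$3$3, - (X$2$3 / n), - (X$1$3 / n)],
     vector [X$5$2, X$4$2, - n * X$3$2, X$2$2, X$1$2],
     vector [X$5$1, X$4$1, - n * X$3$1, X$2$1, X$1$1]]"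
  have "transform (form_mat N) X = form_mat N"
    using assms by (simp add: X_def SO_iff)
  then have f: "X$1$i * X$5$j + X$5$i * X$1$j + X$2$i * X$4$j + X$4$i * X$2$j
      - n * X$3$i * X$3$j = form_mat N $ i $ j" for i j
    unfolding n_def by (metis transform_form_mat)
  have YX: "Y ** X = mat 1"
  proof -
    have "(Y ** X) $ 1 $ j = form_mat N $ 5 $ j" "(Y ** X) $ 2 $ j = form_mat N $ 4 $ j"
      "(Y ** X) $ 4 $ j = form_mat N $ 2 $ j" "(Y ** X) $ 5 $ j = form_mat N $ 1 $ j" for j
      unfolding f[symmetric] by (simp_all add: Y_def matrix_matrix_mult_def sum_UNIV_5 vector_5)
    moreover have "(Y ** X) $ 3 $ j = - form_mat N $ 3 $ j / n" for j
      unfolding f[symmetric] using n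
      by (simp add: Y_def matrix_matrix_mult_def sum_UNIV_5 vector_5 field_simps)
    ultimately show ?thesis
      using n by (simp add: vec_eq_iff forall_5 form_mat_nth mat_def n_def)
  qed
  then have XY: "X ** Y = mat 1" using matrix_left_right_inverse by blast
  have X: "X$k$l = real_of_int (M$k$l) / real m" for k l
    by (simp add: X_def over_m_def real_matrix_nth)
  show sq: "(M$i$3)\<^sup>2 = 4 * int N * (M$i$1 * M$i$5 + M$i$2 * M$i$4)" if "i \<noteq> 3" for i
  proof -
    \<comment> \<open>The entry \<open>(i, 6 - i)\<close> pairs row \<open>i\<close> with itself
      under the inverse form.\<close>
    have "(X ** Y) $ 1 $ 5 = 0" "(X ** Y) $ 2 $ 4 = 0" "(X ** Y) $ 4 $ 2 = 0" "(X ** Y) $ 5 $ 1 = 0"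
      by (simp_all add: XY mat_def)
    then have "2 * n * (X$i$1 * X$i$5 + X$i$2 * X$i$4) = (X$i$3)\<^sup>2"
      using that exhaust_5[of i] n
      by (auto simp: Y_def matrix_matrix_mult_def sum_UNIV_5 vector_5 field_simps power2_eq_square)
    then have "2 * n * (real_of_int (M$i$1) * real_of_int (M$i$5) + real_of_int (M$i$2) * real_of_int (M$i$4))
       = (real_of_int (M$i$3))\<^sup>2"
      using m(1) by (simp add: X field_simps power2_eq_square)
    then have "real_of_int ((M$i$3)\<^sup>2) = real_of_int (4 * int N * (M$i$1 * M$i$5 + M$i$2 * M$i$4))"
      by (simp add: n_def)
    then show ?thesis by (simp only: of_int_eq_iff)
  qed
  show dvd: "2 * int N dvd M$i$3" if "i \<noteq> 3" for i
    using squarefree_dvd_of_square[OF sf sq[OF that]] .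
  have q: "real_of_int (M$i$3 div (2 * int N)) = real m * X$i$3 / n" if "i \<noteq> 3" for i
    using dvd[OF that] m(1) by (simp add: real_of_int_div X n_def)
  have adj: "real_matrix (adjoint_mat N M) = real m *\<^sub>R Y"
    using m(1) by (simp add: vec_eq_iff forall_5 adjoint_mat_def Let_def real_matrix_nth vector_5 Y_def q)
      (simp add: X n_def)
  have M: "real_matrix M = real m *\<^sub>R X"
    using m(1) by (simp add: X_def over_m_def)
  have mat: "real_matrix (mat ((int m)\<^sup>2)) = (real m)\<^sup>2 *\<^sub>R mat 1"
    by (simp add: vec_eq_iff real_matrix_nth mat_def)
  have "real_matrix (adjoint_mat N M ** M) = real_matrix (mat ((int m)\<^sup>2))"
    by (simp add: real_matrix_mult adj M mat scaleR_matrix YX) (simp add: power2_eq_square)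
  then show "adjoint_mat N M ** M = mat ((int m)\<^sup>2)" by (simp only: real_matrix_inject)
  have "real_matrix (M ** adjoint_mat N M) = real_matrix (mat ((int m)\<^sup>2))"
    by (simp add: real_matrix_mult adj M mat scaleR_matrix XY) (simp add: power2_eq_square)
  then show "M ** adjoint_mat N M = mat ((int m)\<^sup>2)" by (simp only: real_matrix_inject)
qed

text \<open>The case \<open>m = 1\<close> of the adjoint identities.\<close>

lemma Gamma_int_inverse:
  assumes "squarefree N" "A \<in> Gamma_int N"
  shows "adjoint_mat N A \<in> Gamma_int N" "adjoint_mat N A ** A = mat 1" "A ** adjoint_mat N A = mat 1"
proof -
  have A: "over_m 1 A \<in> SO N"
    using assms(2) SO0_subset_SO[of N] by (auto simp: Gamma_int_def over_m_def)
  show l: "adjoint_mat N A ** A = mat 1" "A ** adjoint_mat N A = mat 1"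
    using adjoint_mat_left[OF assms(1) _ A] adjoint_mat_right[OF assms(1) _ A] by simp_all
  show "adjoint_mat N A \<in> Gamma_int N"
    using SO0_left_inverse[of "real_matrix A" N "real_matrix (adjoint_mat N A)"] assms(2)
    by (simp add: Gamma_int_def l real_matrix_one flip: real_matrix_mult)
qed

section \<open>Orbits of isotropic vectors\<close>

lemma isotropic_Gamma_int:
  assumes "A \<in> Gamma_int N"
  shows "isotropic N (A *v u) \<longleftrightarrow> isotropic N u"
proof -
  \<comment> \<open>All columns of \<open>C u\<close> equal \<open>u\<close>, so every entry of its
    transform is \<open>2 q(u)\<close> and invariance of \<open>q\<close> follows from invariance of
    the Gram matrix.\<close>
  define C :: "int^5 \<Rightarrow> int^5^5" where "C u = (\<chi> i j. u $ i)" for u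
  have C: "transform (form_mat N) (C u) $ 1 $ 1 = 0 \<longleftrightarrow> isotropic N u" for u :: "int^5"
    by (auto simp: transform_form_mat C_def isotropic_def power2_eq_square)
  have "A ** C u = C (A *v u)"
    by (simp add: C_def vec_eq_iff matrix_matrix_mult_def matrix_vector_mult_def)
  then have "transform (form_mat N) (C (A *v u)) = transform (form_mat N) (C u)"
    using Gamma_int_form[OF assms] by (metis transform_mult)
  then show ?thesis by (metis C)
qed

lemma generator_actions:
  fixes v :: "int^5"
  shows "row_upper t *v v = vector [v$1 - t * v$4, v$2 + t * v$5, v$3, v$4, v$5]"
    "row_lower t *v v = vector [v$1, v$2, v$3, v$4 - t * v$1, v$5 + t * v$2]"
    "col_upper t *v v = vector [v$1, v$2 + t * v$1, v$3, v$4, v$5 - t * v$4]"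
    "eichler5 N t *v v = vector [v$1, v$2, v$3 + t * v$1, v$4, v$5 + 2 * int N * t * v$3 + int N * t * t * v$1]"
    "eichler4 N t *v v = vector [v$1, v$2, v$3 + t * v$2, v$4 + 2 * int N * t * v$3 + int N * t * t * v$2, v$5]"
    "eichler2 N t *v v = vector [v$1, v$2 + 2 * int N * t * v$3 + int N * t * t * v$4, v$3 + t * v$4, v$4, v$5]"
    "row_swap *v v = vector [- v$4, v$5, v$3, v$1, - v$2]"
    "col_swap *v v = vector [- v$2, v$1, v$3, v$5, - v$4]"
  by (simp_all add: generator_defs row_swap_def col_swap_def vec_eq_iff forall_5 matrix_vector_mult_def
      sum_UNIV_5 vector_5)

text \<open>Take a nonzero first coordinate \<open>c\<close> of least absolute value in the orbit.
  Euclidean division makes it divide the coordinates that swaps can bring to the front; isotropy and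
  squarefreeness then handle the anisotropic coordinate.\<close>

lemma isotropic_orbit:
  assumes sf: "squarefree N" and iso: "isotropic N u" and "u \<noteq> 0"
  shows "\<exists>A\<in>Gamma_int N. \<exists>c. c \<noteq> 0 \<and> A *v u = vector [c, 0, 0, 0, 0]"
proof -
  have N: "N > 0" by (rule squarefree_nat_pos[OF sf])
  note gen = generators_Gamma_int[OF N] swaps_Gamma_int[OF N]
  define Orb where "Orb = {A *v u | A. A \<in> Gamma_int N}"
  have step: "A *v w \<in> Orb" if "w \<in> Orb" "A \<in> Gamma_int N" for A w
    using that Gamma_int_mult by (fastforce simp: Orb_def matrix_vector_mul_assoc)
  have u: "u \<in> Orb" using Gamma_int_one[of N] by (force simp: Orb_def)
  have isoO: "isotropic N w" if "w \<in> Orb" for w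
    using that iso isotropic_Gamma_int by (auto simp: Orb_def)
  have "\<exists>w\<in>Orb. w$1 \<noteq> 0"
  proof -
    have "u$1 \<noteq> 0 \<or> u$2 \<noteq> 0 \<or> u$4 \<noteq> 0 \<or> u$5 \<noteq> 0"
    proof (rule ccontr)
      assume "\<not> ?thesis"
      then show False using iso \<open>u \<noteq> 0\<close> N by (auto simp: isotropic_def vec_eq_iff forall_5)
    qed
    moreover have "(col_swap *v u)$1 = - u$2" "(row_swap *v u)$1 = - u$4"
      "(col_swap *v (row_swap *v u))$1 = - u$5"
      by (simp_all add: generator_actions vector_5)
    ultimately show ?thesis using u step gen by (metis neg_equal_0_iff_equal)
  qed
  then obtain w0 where w0: "w0 \<in> Orb" "w0$1 \<noteq> 0"
    and min0: "\<And>w. w \<in> Orb \<Longrightarrow> w$1 \<noteq> 0 \<Longrightarrow> nat \<bar>w0$1\<bar> \<le> nat \<bar>w$1\<bar>"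
    using ex_has_least_nat[of "\<lambda>w. w \<in> Orb \<and> w$1 \<noteq> 0" _ "\<lambda>w. nat \<bar>w$1\<bar>"] by (metis (lifting))
  define c where "c = w0$1"
  have c: "c \<noteq> 0" using w0 by (simp add: c_def)
  have min: "\<bar>c\<bar> \<le> \<bar>w$1\<bar>" if "w \<in> Orb" "w$1 \<noteq> 0" for w
    using min0[OF that] by (simp add: c_def)
  have dvd2: "c dvd w$2" if "w \<in> Orb" "w$1 = c" for w
  proof (rule ccontr)
    assume "\<not> c dvd w$2"
    \<comment> \<open>The swap brings the remainder of the division by \<open>c\<close> to the first
      place, where a nonzero value would contradict minimality.\<close>
    moreover have "(col_swap *v (col_upper (- (w$2 div c)) *v w))$1 = - (w$2 mod c)"
      by (simp add: generator_actions vector_5 that(2) minus_div_mult_eq_mod[symmetric])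
    ultimately have "\<bar>c\<bar> \<le> \<bar>w$2 mod c\<bar>"
      using min step that(1) gen by (metis abs_minus_cancel dvd_eq_mod_eq_0 neg_equal_0_iff_equal)
    then show False using abs_mod_less[OF c, of "w$2"] by simp
  qed
  have dvd4: "c dvd w$4" if "w \<in> Orb" "w$1 = c" for w
  proof (rule ccontr)
    assume "\<not> c dvd w$4"
    moreover have "(row_swap *v (row_lower (w$4 div c) *v w))$1 = - (w$4 mod c)"
      by (simp add: generator_actions vector_5 that(2) minus_div_mult_eq_mod[symmetric])
    ultimately have "\<bar>c\<bar> \<le> \<bar>w$4 mod c\<bar>"
      using min step that(1) gen by (metis abs_minus_cancel dvd_eq_mod_eq_0 neg_equal_0_iff_equal)
    then show False using abs_mod_less[OF c, of "w$4"] by simp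
  qed
  obtain w where w: "w \<in> Orb" "w$1 = c" "w$2 = 0" "w$4 = 0"
  proof
    let ?w = "row_lower (w0$4 div c) *v (col_upper (- (w0$2 div c)) *v w0)"
    show "?w \<in> Orb" using step gen w0(1) by blast
    show "?w$1 = c" "?w$2 = 0" "?w$4 = 0"
      using dvd2[OF w0(1)] dvd4[OF w0(1)] by (simp_all add: generator_actions vector_5 c_def)
  qed
  \<comment> \<open>Since \<open>w$2\<close> and \<open>w$4\<close> vanish, this operation copies
    \<open>w$5\<close> into the second place and leaves the first unchanged, so \<open>dvd2\<close>
    applies.\<close>
  have "c dvd (row_upper 1 *v w)$2"
    using dvd2[OF step[OF w(1) gen(1)[of 1]]] w by (simp add: generator_actions vector_5)
  then have d5: "c dvd w$5" using w by (simp add: generator_actions vector_5)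
  have "c * w$5 = int N * (w$3)\<^sup>2" using isoO[OF w(1)] w by (simp add: isotropic_def)
  then have "c\<^sup>2 dvd int N * (w$3)\<^sup>2" using d5 by (metis dvd_refl mult_dvd_mono power2_eq_square)
  then have d3: "c dvd w$3" by (rule squarefree_square_dvd[OF sf])
  let ?w = "eichler5 N (- (w$3 div c)) *v w"
  have wO: "?w \<in> Orb" using step gen w(1) by blast
  have w': "?w$1 = c" "?w$2 = 0" "?w$3 = 0" "?w$4 = 0"
    using w d3 by (simp_all add: generator_actions vector_5)
  \<comment> \<open>With the three middle coordinates zero, isotropy reads
    \<open>c * ?w$5 = 0\<close>.\<close>
  moreover have "?w$5 = 0"
    using isoO[OF wO] w' c by (simp add: isotropic_def)
  ultimately have "?w = vector [c, 0, 0, 0, 0]"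
    by (simp add: vec_eq_iff forall_5 vector_5)
  then have "vector [c, 0, 0, 0, 0] \<in> Orb" using wO by simp
  then show ?thesis using c by (fastforce simp: Orb_def)
qed

section \<open>The subgroup acting on the ternary form in the coordinates 2, 3, 4\<close>

lemma matrix_mult_nth_5:
  fixes A B :: "'a::comm_ring_1^5^5"
  shows "(A ** B) $ i $ j = A$i$1 * B$1$j + A$i$2 * B$2$j + A$i$3 * B$3$j + A$i$4 * B$4$j + A$i$5 * B$5$j"
  by (simp add: matrix_matrix_mult_def sum_UNIV_5)

text \<open>Elements fixing \<open>e1\<close> and \<open>e5\<close> and preserving the span of the
  other basis vectors; multiplying by them keeps a first row and column that have already been
  cleared.\<close>

definition Gamma_levi :: "nat \<Rightarrow> (int^5^5) set" where
  "Gamma_levi N = {A \<in> Gamma_int N. A$1$1 = 1 \<and> A$5$5 = 1 \<and>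
     (\<forall>j. j \<noteq> 1 \<longrightarrow> A$1$j = 0 \<and> A$j$1 = 0) \<and> (\<forall>j. j \<noteq> 5 \<longrightarrow> A$5$j = 0 \<and> A$j$5 = 0)}"

lemma Gamma_levi_one: "mat 1 \<in> Gamma_levi N"
  using Gamma_int_one[of N] by (auto simp: Gamma_levi_def) (auto simp: mat_def)

lemma Gamma_levi_mult: "A \<in> Gamma_levi N \<Longrightarrow> B \<in> Gamma_levi N \<Longrightarrow> A ** B \<in> Gamma_levi N"
  by (simp add: Gamma_levi_def Gamma_int_mult forall_5 matrix_mult_nth_5)

lemma Gamma_levi_inverse:
  "squarefree N \<Longrightarrow> A \<in> Gamma_levi N \<Longrightarrow> adjoint_mat N A \<in> Gamma_levi N"
  by (simp add: Gamma_levi_def Gamma_int_inverse forall_5) (simp add: adjoint_mat_def Let_def vector_5)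

lemma eichler_Gamma_levi:
  "N > 0 \<Longrightarrow> eichler4 N t \<in> Gamma_levi N" "N > 0 \<Longrightarrow> eichler2 N t \<in> Gamma_levi N"
  by (simp_all add: Gamma_levi_def generators_Gamma_int forall_5)
    (simp_all add: eichler4_def eichler2_def vector_5)

text \<open>Produces the square root of \<open>p\<close> explicitly: squaring the gcd gives
  \<open>gcd (p * p) (p * q)\<close>, which is \<open>p\<close> by coprimality.\<close>

lemma coprime_mult_square_int:
  fixes p q x :: int
  assumes "coprime p q" "p * q = x\<^sup>2" "p \<ge> 0"
  shows "(gcd p x)\<^sup>2 = p"
proof -
  have "(gcd p x)\<^sup>2 = gcd (p * p) (p * q)"
    by (metis assms(2) gcd_exp power2_eq_square)
  also have "\<dots> = p" using assms(1,3) by (simp add: gcd_mult_left)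
  finally show ?thesis .
qed

text \<open>A primitive solution of \<open>x\<^sub>2 x\<^sub>4 = N x\<^sub>3\<^sup>2\<close> is \<open>(a s\<^sup>2, s r, b r\<^sup>2)\<close> with \<open>N = a b\<close>.\<close>

lemma levi_orbit_primitive:
  fixes x2 x3 x4 :: int
  assumes sf: "squarefree N" and eq: "x2 * x4 = int N * x3\<^sup>2" and pos: "x2 > 0"
    and prim: "gcd x2 (gcd x3 x4) = 1"
  shows "\<exists>A\<in>Gamma_levi N. A *v vector [0, x2, x3, x4, 0] = vector [0, 1, 0, 0, 0]"
proof -
  have N: "N > 0" by (rule squarefree_nat_pos[OF sf])
  define a where "a = gcd x2 (int N)"
  have a: "a > 0" using pos by (simp add: a_def)
  obtain p b where pb: "x2 = a * p" "int N = a * b" "coprime p b"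
    using a gcd_coprime_exists[of x2 "int N"] unfolding a_def by (metis less_irrefl mult.commute)
  have p: "p > 0" using pos a pb(1) by (simp add: zero_less_mult_iff)
  have b: "b > 0" using N a pb(2) by (metis of_nat_0_less_iff zero_less_mult_pos)
  have "p * x4 = b * x3\<^sup>2" using eq a by (simp add: pb)
  then have "b dvd x4" using pb(3) by (metis coprime_commute coprime_dvd_mult_right_iff dvd_triv_left)
  then obtain q where q: "x4 = b * q" by blast
  have pq: "p * q = x3\<^sup>2" using \<open>p * x4 = b * x3\<^sup>2\<close> b q by simp
  then have q0: "q \<ge> 0" using p by (metis zero_le_mult_iff zero_le_power2 less_le_not_le)
  have no_prime: False if "prime d" "d dvd x2" "d dvd x3" "d dvd x4" for d
    using that prim by (metis gcd_greatest not_prime_unit)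
  have coprimeI: "coprime u v" if "u \<noteq> 0" "\<And>d. prime d \<Longrightarrow> d dvd u \<Longrightarrow> d dvd v \<Longrightarrow> False" for u v :: int
  proof (rule ccontr)
    assume "\<not> coprime u v"
    then have "\<not> is_unit (gcd u v)" by (simp only: is_unit_gcd not_False_eq_True)
    moreover have "gcd u v \<noteq> 0" using that(1) by simp
    ultimately obtain d where "d dvd gcd u v" "prime d" using prime_divisor_exists by blast
    then show False using that(2)[of d] by simp
  qed
  have cpq: "coprime p q"
  proof (rule coprimeI)
    show False if d: "prime d" "d dvd p" "d dvd q" for d
    proof -
      have "d dvd x3" using pq d by (metis dvd_mult2 prime_dvd_power)
      then show False using no_prime[OF d(1)] d by (simp add: pb(1) q)
    qed
  qed (use p in simp)
  define s where "s = gcd p x3"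
  have s: "s * s = p" "s > 0"
    using coprime_mult_square_int[OF cpq pq] p by (auto simp: s_def power2_eq_square)
  \<comment> \<open>The sign makes \<open>s * r\<close> equal to \<open>x3\<close> and not to its
    negative.\<close>
  define r where "r = (if x3 < 0 then - gcd q x3 else gcd q x3)"
  have r: "r * r = q"
    using coprime_mult_square_int[of q p x3] cpq pq q0
    by (auto simp: r_def power2_eq_square coprime_commute mult.commute)
  have "(s * r)\<^sup>2 = x3\<^sup>2" using s(1) r pq by (metis power_mult_distrib power2_eq_square)
  then have "s * r = x3 \<or> s * r = - x3" by (simp add: power2_eq_iff)
  moreover have "s * r \<le> 0" if "x3 < 0" using that s(2) by (simp add: r_def mult_nonneg_nonpos)
  moreover have "s * r \<ge> 0" if "x3 \<ge> 0" using that s(2) by (simp add: r_def)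
  ultimately have sr: "s * r = x3" by linarith
  \<comment> \<open>This is what Bezout needs to complete the column \<open>(a * s, b * r)\<close>
    to determinant 1. A prime common to \<open>a\<close> and \<open>b\<close> is excluded because
    its square would divide \<open>N\<close>; the mixed cases contradict primitivity or the
    coprimality of \<open>p\<close> with \<open>b\<close> and with \<open>q\<close>.\<close>
  have "coprime (a * s) (b * r)"
  proof (rule coprimeI)
    show False if d: "prime d" "d dvd a * s" "d dvd b * r" for d
    proof -
      have "d dvd a \<or> d dvd s" "d dvd b \<or> d dvd r"
        using d prime_dvd_mult_iff by blast+
      moreover have False if "d dvd a" "d dvd b"
      proof -
        have "d\<^sup>2 dvd int N * 1\<^sup>2" using that by (simp add: pb(2) power2_eq_square mult_dvd_mono)
        then show False using squarefree_square_dvd[OF sf] d(1) not_prime_unit by blast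
      qed
      moreover have False if "d dvd a" "d dvd r"
        using that no_prime[OF d(1)] by (simp add: pb(1) q flip: sr r)
      moreover have False if "d dvd s" "d dvd b"
        using that pb(3) d(1) s(1) by (metis coprime_common_divisor dvd_mult not_prime_unit)
      moreover have False if "d dvd s" "d dvd r"
        using that cpq d(1) s(1) r by (metis coprime_common_divisor dvd_mult not_prime_unit)
      ultimately show False by blast
    qed
  qed (use a s in simp)
  then obtain w l where wl: "a * s * w + b * r * l = 1"
    by (metis bezout_int coprime_iff_gcd_eq_1 mult.commute)
  define C where "C = atkin_lehner a b s (-l) r w"
  have C: "C \<in> Gamma_levi N"
    using atkin_lehner_Gamma_int[OF N a _ pb(2), of s w "-l" r] s(2) wl
    by (simp add: C_def Gamma_levi_def forall_5 algebra_simps) (simp add: atkin_lehner_def vector_5)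
  have "C *v vector [0, 1, 0, 0, 0] = vector [0, x2, x3, x4, 0]"
    using s r sr pb(1) q by (simp add: C_def atkin_lehner_def matrix_5_simps mult.assoc)
  then have "adjoint_mat N C *v vector [0, x2, x3, x4, 0] = vector [0, 1, 0, 0, 0]"
    using Gamma_int_inverse(2)[OF sf, of C] C
    by (metis (no_types, lifting) Gamma_levi_def matrix_vector_mul_assoc matrix_vector_mul_lid mem_Collect_eq)
  then show ?thesis using Gamma_levi_inverse[OF sf C] by blast
qed

lemma levi_orbit_aux:
  assumes sf: "squarefree N" and iso: "isotropic N u" and u: "u$1 = 0" "u$5 = 0" "u$2 \<noteq> 0"
  shows "\<exists>A\<in>Gamma_levi N. \<exists>c. c \<noteq> 0 \<and> A *v u = vector [0, c, 0, 0, 0]"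
proof -
  define g where "g = gcd (u$2) (gcd (u$3) (u$4))"
  \<comment> \<open>The content carries the sign of \<open>u$2\<close>, so that the primitive
    quotient has positive second coordinate.\<close>
  define k where "k = sgn (u$2) * g"
  have g: "g > 0" using u(3) by (simp add: g_def)
  have k: "k \<noteq> 0" using u(3) g by (simp add: k_def sgn_0_0)
  have "k dvd u$2" "k dvd u$3" "k dvd u$4"
    using u(3) by (auto simp: k_def g_def sgn_if intro: dvd_trans[OF gcd_dvd2])
  then obtain x2 x3 x4 where x: "u$2 = k * x2" "u$3 = k * x3" "u$4 = k * x4"
    by (metis dvd_def)
  have "k\<^sup>2 * (x2 * x4) = k\<^sup>2 * (int N * x3\<^sup>2)"
    using iso by (simp add: isotropic_def u x power2_eq_square algebra_simps)
  then have eq: "x2 * x4 = int N * x3\<^sup>2" using k by simp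
  have "g * gcd x2 (gcd x3 x4) = g"
  proof -
    have "\<bar>k\<bar> = g" using g u(3) by (simp add: k_def abs_mult)
    moreover have "g = \<bar>k\<bar> * gcd x2 (gcd x3 x4)"
    proof -
      have "gcd (k * x2) (\<bar>k\<bar> * gcd x3 x4) = gcd (k * x2) (k * gcd x3 x4)"
        by (cases "k \<ge> 0") auto
      then show ?thesis by (simp add: g_def x flip: gcd_mult_distrib_int)
    qed
    ultimately show ?thesis by metis
  qed
  then have prim: "gcd x2 (gcd x3 x4) = 1" using g by simp
  have pos: "x2 > 0"
    using x(1) g u(3) by (auto simp: k_def sgn_if zero_less_mult_iff mult_less_0_iff split: if_splits)
  obtain A where A: "A \<in> Gamma_levi N" "A *v vector [0, x2, x3, x4, 0] = vector [0, 1, 0, 0, 0]"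
    using levi_orbit_primitive[OF sf eq pos prim] by blast
  have "u = k *s vector [0, x2, x3, x4, 0]"
    using x u by (simp add: vec_eq_iff forall_5 vector_5)
  moreover have "A *v (k *s v) = k *s (A *v v)" for v
    by (simp add: vec_eq_iff matrix_vector_mult_def sum_distrib_left mult.left_commute)
  ultimately have "A *v u = k *s vector [0, 1, 0, 0, 0]"
    using A(2) by simp
  then have "A *v u = vector [0, k, 0, 0, 0]"
    by (simp add: vec_eq_iff forall_5 vector_5)
  then show ?thesis using A(1) k by blast
qed

lemma levi_orbit:
  assumes sf: "squarefree N" and iso: "isotropic N u" and u: "u$1 = 0" "u$5 = 0" "u \<noteq> 0"
  shows "\<exists>A\<in>Gamma_levi N. \<exists>c. c \<noteq> 0 \<and> A *v u = vector [0, c, 0, 0, 0]"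
proof (cases "u$2 = 0")
  case True
  have N: "N > 0" by (rule squarefree_nat_pos[OF sf])
  have u3: "u$3 = 0" using iso True N by (simp add: isotropic_def u)
  have u4: "u$4 \<noteq> 0" using u u3 True by (auto simp: vec_eq_iff forall_5)
  \<comment> \<open>Here only \<open>u$4\<close> survives, and this transvection puts
    \<open>N * u$4\<close> into the second place.\<close>
  let ?v = "eichler2 N 1 *v u"
  have v: "?v$1 = 0" "?v$5 = 0" "?v$2 \<noteq> 0"
    using u u4 N u3 True by (simp_all add: generator_actions vector_5)
  have "isotropic N ?v"
    using iso isotropic_Gamma_int generators_Gamma_int[OF N] by blast
  then obtain A c where "A \<in> Gamma_levi N" "c \<noteq> 0" "A *v ?v = vector [0, c, 0, 0, 0]"
    using levi_orbit_aux[OF sf _ v] by blast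
  then show ?thesis
    using Gamma_levi_mult[OF _ eichler_Gamma_levi(2)[OF N]] by (metis matrix_vector_mul_assoc)
qed (use levi_orbit_aux[OF sf iso u(1,2)] in blast)

definition levi_swap :: "int^5^5" where
  "levi_swap = vector [vector [1, 0, 0, 0, 0], vector [0, 0, 0, 1, 0], vector [0, 0, -1, 0, 0],
     vector [0, 1, 0, 0, 0], vector [0, 0, 0, 0, 1]]"

text \<open>The swap is an Atkin--Lehner element with \<open>s = 0\<close>, where the pivot of the
  factorisation vanishes; a unipotent factor moves it to \<open>s = 1\<close>.\<close>

lemma levi_swap_Gamma_levi:
  assumes N: "N > 0"
  shows "levi_swap \<in> Gamma_levi N"
proof -
  have "levi_swap = eichler2 N (-1) ** atkin_lehner (int N) 1 1 (-1) 1 0"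
    by (simp add: levi_swap_def eichler2_def atkin_lehner_def matrix_5_simps)
  also have "\<dots> \<in> Gamma_int N"
    using N by (intro Gamma_int_mult generators_Gamma_int atkin_lehner_Gamma_int) auto
  finally show ?thesis
    by (simp add: Gamma_levi_def forall_5) (simp add: levi_swap_def vector_5)
qed

section \<open>Rows and columns as isotropic vectors, and minimal pivots\<close>

text \<open>Because \<open>B\<close> preserves the Gram matrix, right multiplication by
  \<open>B\<close> acts on the vector dual to a row as the inverse of \<open>B\<close>.\<close>

lemma row_mult_Gamma_int:
  assumes "B \<in> Gamma_int N" "M $ i = form_mat N *v (B *v v)"
  shows "(M ** B) $ i = form_mat N *v v"
proof -
  have "(M ** B) $ i = transpose B *v (M $ i)"
    by (simp add: vec_eq_iff matrix_matrix_mult_def matrix_vector_mult_def transpose_def mult.commute)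
  also have "\<dots> = transform (form_mat N) B *v v"
    by (simp add: assms(2) transform_def matrix_vector_mul_assoc matrix_mul_assoc)
  finally show ?thesis by (simp add: Gamma_int_form[OF assms(1)])
qed

text \<open>The inverse Gram matrix applied to row \<open>i\<close>; for \<open>i\<close> other than
  3 the division is exact by \<open>third_column_dvd\<close>.\<close>

definition dual_row :: "nat \<Rightarrow> int^5^5 \<Rightarrow> 5 \<Rightarrow> int^5" where
  "dual_row N M i = vector [M$i$5, M$i$4, - (M$i$3 div (2 * int N)), M$i$2, M$i$1]"

lemma dual_row:
  assumes sf: "squarefree N" and m: "m > 0" "over_m m M \<in> SO N" and i: "i \<noteq> 3"
  shows "M $ i = form_mat N *v dual_row N M i" "isotropic N (dual_row N M i)" "dual_row N M i \<noteq> 0"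
proof -
  have N: "N > 0" by (rule squarefree_nat_pos[OF sf])
  obtain k where k: "M$i$3 = 2 * int N * k"
    using third_column_dvd[OF sf m i] by blast
  show eq: "M $ i = form_mat N *v dual_row N M i"
    using N by (simp add: vec_eq_iff forall_5 form_mat_nth dual_row_def matrix_vector_mult_def sum_UNIV_5 vector_5 k)
  have "4 * int N * (int N * k\<^sup>2) = 4 * int N * (M$i$1 * M$i$5 + M$i$2 * M$i$4)"
    using row_form[OF sf m i] by (simp add: k power2_eq_square algebra_simps)
  then have "int N * k\<^sup>2 = M$i$1 * M$i$5 + M$i$2 * M$i$4" using N by simp
  then show "isotropic N (dual_row N M i)"
    using N by (simp add: isotropic_def dual_row_def vector_5 k algebra_simps)
  show "dual_row N M i \<noteq> 0"
  proof
    assume "dual_row N M i = 0"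
    then have "M $ i = 0" using eq by simp
    then have "(M ** adjoint_mat N M) $ i $ i = 0"
      by (simp add: matrix_matrix_mult_def)
    then show False using adjoint_mat_right[OF sf m] m(1) by (simp add: mat_def)
  qed
qed

lemma column_isotropic:
  assumes sf: "squarefree N" and m: "m > 0" "over_m m M \<in> SO N" and i: "i \<noteq> 3"
  shows "isotropic N (column i M)" "column i M \<noteq> 0"
proof -
  have "transform (form_mat N) M $ i $ i = 0"
    using over_m_form[OF m] i exhaust_5[of i] by (auto simp: form_mat_nth)
  then show "isotropic N (column i M)"
    by (simp add: transform_form_mat isotropic_def column_def power2_eq_square)
  show "column i M \<noteq> 0"
  proof
    assume "column i M = 0"
    then have "(adjoint_mat N M ** M) $ i $ i = 0"
      by (simp add: matrix_matrix_mult_def column_def vec_eq_iff)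
    then show False using adjoint_mat_left[OF sf m] m(1) by (simp add: mat_def)
  qed
qed

lemma over_m_SO0_mult:
  assumes "over_m m M \<in> SO0 N" "A \<in> Gamma_int N" "B \<in> Gamma_int N"
  shows "over_m m (A ** M ** B) \<in> SO0 N"
  using assms by (simp add: over_m_mult Gamma_int_def SO0_mult)

lemma column_mult: "column i (A ** M) = A *v column i M"
  by (simp add: vec_eq_iff column_def matrix_matrix_mult_def matrix_vector_mult_def)

text \<open>Minimising the absolute value of the nonzero \<open>(i, i)\<close> entries over the double orbit.\<close>

lemma minimal_pivot:
  fixes G :: "(int^5^5) set" and M :: "int^5^5"
  assumes one: "mat 1 \<in> G" and mult: "\<And>A B. A \<in> G \<Longrightarrow> B \<in> G \<Longrightarrow> A ** B \<in> G"
    and inv: "\<And>A. A \<in> G \<Longrightarrow> \<exists>A'. A' ** A = mat 1 \<and> A ** A' = mat 1"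
    and col: "\<And>A B. A \<in> G \<Longrightarrow> B \<in> G \<Longrightarrow>
      \<exists>C\<in>G. \<exists>c. c \<noteq> 0 \<and> C *v column i (A ** M ** B) = c *s axis i 1"
    and row: "\<And>A B. A \<in> G \<Longrightarrow> B \<in> G \<Longrightarrow>
      \<exists>C\<in>G. \<exists>c. c \<noteq> 0 \<and> (A ** M ** B ** C) $ i = c *s axis i 1"
  shows "\<exists>A\<in>G. \<exists>B\<in>G. \<exists>c. c \<noteq> 0 \<and> (A ** M ** B) $ i = c *s axis i 1 \<and>
    (\<forall>A'\<in>G. \<forall>B'\<in>G. (A' ** (A ** M ** B) ** B') $ i $ i = c \<longrightarrow>
      (\<forall>j. c dvd (A' ** (A ** M ** B) ** B') $ j $ i))"
proof -
  define Orb where "Orb = {A ** M ** B | A B. A \<in> G \<and> B \<in> G}"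
  have Orb: "A ** X ** B \<in> Orb" if "X \<in> Orb" "A \<in> G" "B \<in> G" for X A B
  proof -
    obtain A0 B0 where X: "X = A0 ** M ** B0" "A0 \<in> G" "B0 \<in> G"
      using \<open>X \<in> Orb\<close> by (auto simp: Orb_def)
    have "A ** X ** B = (A ** A0) ** M ** (B0 ** B)" by (simp add: X matrix_mul_assoc)
    then show ?thesis using mult that X by (auto simp: Orb_def)
  qed
  have OrbL: "A ** X \<in> Orb" if "X \<in> Orb" "A \<in> G" for X A
    using Orb[OF that one] by simp
  have OrbR: "X ** B \<in> Orb" if "X \<in> Orb" "B \<in> G" for X B
    using Orb[OF that(1) one that(2)] by simp
  have M: "M \<in> Orb" using one by (force simp: Orb_def)
  have col': "\<exists>C\<in>G. \<exists>c. c \<noteq> 0 \<and> C *v column i X = c *s axis i 1" if "X \<in> Orb" for X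
    using that col by (auto simp: Orb_def)
  have row': "\<exists>C\<in>G. \<exists>c. c \<noteq> 0 \<and> (X ** C) $ i = c *s axis i 1" if "X \<in> Orb" for X
    using that row by (auto simp: Orb_def)
  have diag_entry: "(C ** X) $ i $ i = c" if "C *v column i X = c *s axis i 1" for C X c
  proof -
    have "(C ** X) $ i $ i = (C *v column i X) $ i"
      by (simp add: column_def matrix_vector_mult_def matrix_matrix_mult_def)
    then show ?thesis using that by simp
  qed
  have "\<exists>X. X \<in> Orb \<and> X $ i $ i \<noteq> 0"
    using col'[OF M] diag_entry OrbL[OF M] by metis
  then obtain X0 where X0: "X0 \<in> Orb" "X0 $ i $ i \<noteq> 0"
    and min0: "\<And>X. X \<in> Orb \<Longrightarrow> X $ i $ i \<noteq> 0 \<Longrightarrow> nat \<bar>X0 $ i $ i\<bar> \<le> nat \<bar>X $ i $ i\<bar>"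
    using ex_has_least_nat[of "\<lambda>X. X \<in> Orb \<and> X $ i $ i \<noteq> 0" _ "\<lambda>X. nat \<bar>X $ i $ i\<bar>"] by (metis (lifting))
  obtain C c where C: "C \<in> G" "c \<noteq> 0" "(X0 ** C) $ i = c *s axis i 1"
    using row'[OF X0(1)] by blast
  define X1 where "X1 = X0 ** C"
  have X1: "X1 \<in> Orb" using OrbR X0 C by (simp add: X1_def)
  obtain C' where C': "C ** C' = mat 1" using inv C(1) by blast
  \<comment> \<open>Undoing \<open>C\<close> shows that \<open>c\<close> divides the minimal entry
    of \<open>X0\<close>, so \<open>c\<close> attains the minimum as well.\<close>
  have "X0 = X1 ** C'" by (metis X1_def C' matrix_mul_assoc matrix_mul_rid)
  then have "X0 $ i $ i = (\<Sum>k\<in>UNIV. X1 $ i $ k * C' $ k $ i)"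
    by (simp add: matrix_matrix_mult_def)
  also have "\<dots> = c * C' $ i $ i"
    using C(3) by (simp add: X1_def axis_def if_distrib[of "\<lambda>a. a * _"] if_distrib[of "\<lambda>a. _ * a"] cong: if_cong)
  finally have "c dvd X0 $ i $ i" by simp
  then have "\<bar>c\<bar> \<le> \<bar>X0 $ i $ i\<bar>" using X0(2) by (simp add: dvd_imp_le_int)
  then have min: "\<bar>c\<bar> \<le> \<bar>X $ i $ i\<bar>" if "X \<in> Orb" "X $ i $ i \<noteq> 0" for X
    using min0[OF that] by linarith
  \<comment> \<open>Reducing column \<open>i\<close> to a multiple \<open>d\<close> of the basis
    vector gives a pivot \<open>d\<close> that divides the whole column, in particular
    \<open>c\<close>. Minimality of \<open>c\<close> then makes \<open>c\<close> and
    \<open>d\<close> associated.\<close>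
  have key: "c dvd Y $ j $ i" if Y: "Y \<in> Orb" "Y $ i $ i = c" for Y j
  proof -
    obtain D d where D: "D \<in> G" "d \<noteq> 0" "D *v column i Y = d *s axis i 1"
      using col'[OF Y(1)] by blast
    obtain D' where D': "D' ** D = mat 1" using inv D(1) by blast
    have "column i Y = D' *v (d *s axis i 1)"
      by (metis D(3) D' matrix_vector_mul_assoc matrix_vector_mul_lid)
    then have "d dvd column i Y $ j" for j
      by (auto simp: matrix_vector_mult_def intro!: dvd_sum)
    then have d: "d dvd Y $ j $ i" for j by (simp add: column_def)
    have "\<bar>c\<bar> \<le> \<bar>d\<bar>"
      using min[OF OrbL[OF Y(1) D(1)]] diag_entry[OF D(3)] D(2) by simp
    moreover have "d dvd c" using d Y(2) by metis
    ultimately have "c dvd d" using C(2)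
      by (metis abs_dvd_iff dvd_abs_iff dvd_imp_le_int dvd_refl order_antisym)
    then show ?thesis using d dvd_trans by blast
  qed
  obtain A B where AB: "A \<in> G" "B \<in> G" "X1 = A ** M ** B" using X1 by (auto simp: Orb_def)
  have "X1 $ i = c *s axis i 1" using C(3) by (simp add: X1_def)
  then show ?thesis using AB C(2) key Orb[OF X1] by blast
qed

section \<open>Reduction to diagonal form\<close>

definition block_diagonal :: "int^5^5 \<Rightarrow> bool" where
  "block_diagonal M \<longleftrightarrow> (\<forall>j. (j \<noteq> 1 \<longrightarrow> M$1$j = 0 \<and> M$j$1 = 0) \<and> (j \<noteq> 5 \<longrightarrow> M$5$j = 0 \<and> M$j$5 = 0))"

lemma block_diagonal_levi:
  assumes "block_diagonal M" "A \<in> Gamma_levi N" "B \<in> Gamma_levi N"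
  shows "block_diagonal (A ** M ** B)" "(A ** M ** B)$1$1 = M$1$1" "(A ** M ** B)$5$5 = M$5$5"
  using assms by (simp_all add: block_diagonal_def Gamma_levi_def forall_5 matrix_mult_nth_5)

lemma dvd_matrix_mult:
  fixes A B M :: "int^5^5"
  assumes "\<And>i j. c dvd M$i$j"
  shows "c dvd (A ** M ** B)$i$j"
  using assms by (simp add: matrix_mult_nth_5)

section \<open>The pivot in position \<open>(1, 1)\<close>\<close>

lemma first_pivot_row:
  assumes sf: "squarefree N" and m: "m > 0" "over_m m M \<in> SO0 N"
  shows "\<exists>A\<in>Gamma_int N. \<exists>B\<in>Gamma_int N. \<exists>c. c \<noteq> 0 \<and> (A ** M ** B) $ 1 = c *s axis 1 1 \<and>
    (\<forall>A'\<in>Gamma_int N. \<forall>B'\<in>Gamma_int N. (A' ** (A ** M ** B) ** B') $ 1 $ 1 = c \<longrightarrow>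
      (\<forall>j. c dvd (A' ** (A ** M ** B) ** B') $ j $ 1))"
proof -
  have N: "N > 0" by (rule squarefree_nat_pos[OF sf])
  note gen = generators_Gamma_int[OF N] swaps_Gamma_int[OF N]
  have SO: "over_m m (A ** M ** B) \<in> SO N" if "A \<in> Gamma_int N" "B \<in> Gamma_int N" for A B
    using over_m_SO0_mult[OF m(2) that] SO0_subset_SO by blast
  show ?thesis
  proof (rule minimal_pivot)
    show "\<exists>A'. A' ** A = mat 1 \<and> A ** A' = mat 1" if "A \<in> Gamma_int N" for A
      using Gamma_int_inverse[OF sf that] by blast
    show "\<exists>C\<in>Gamma_int N. \<exists>c. c \<noteq> 0 \<and> C *v column 1 (A ** M ** B) = c *s axis 1 1"
      if "A \<in> Gamma_int N" "B \<in> Gamma_int N" for A B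
    proof -
      have "vector [c, 0, 0, 0, 0] = c *s (axis 1 1 :: int^5)" for c
        by (simp add: vec_eq_iff forall_5 vector_5 axis_def)
      then show ?thesis
        using isotropic_orbit[OF sf column_isotropic[OF sf m(1) SO[OF that], of 1]] by auto
    qed
    show "\<exists>C\<in>Gamma_int N. \<exists>c. c \<noteq> 0 \<and> (A ** M ** B ** C) $ 1 = c *s axis 1 1"
      if AB: "A \<in> Gamma_int N" "B \<in> Gamma_int N" for A B
    proof -
      let ?X = "A ** M ** B"
      note dr = dual_row[OF sf m(1) SO[OF AB], of 1]
      obtain D c where D: "D \<in> Gamma_int N" "c \<noteq> 0" "D *v dual_row N ?X 1 = vector [c, 0, 0, 0, 0]"
        using isotropic_orbit[OF sf dr(2,3)] by auto
      \<comment> \<open>The Gram matrix sends \<open>e5\<close> to \<open>e1\<close>, so the dual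
        vector has to end on the \<open>e5\<close> axis for the row to end on the \<open>e1\<close>
        axis.\<close>
      define E where "E = col_swap ** (row_swap ** D)"
      have E: "E \<in> Gamma_int N" "E *v dual_row N ?X 1 = vector [0, 0, 0, 0, - c]"
        using D(1) gen D(3) by (simp_all add: E_def Gamma_int_mult generator_actions vector_5
            flip: matrix_vector_mul_assoc)
      note inv = Gamma_int_inverse[OF sf E(1)]
      have "dual_row N ?X 1 = adjoint_mat N E *v vector [0, 0, 0, 0, - c]"
        by (metis E(2) inv(2) matrix_vector_mul_assoc matrix_vector_mul_lid)
      then have "(?X ** adjoint_mat N E) $ 1 = form_mat N *v vector [0, 0, 0, 0, - c]"
        using row_mult_Gamma_int[OF inv(1)] dr(1) by simp
      also have "\<dots> = (- c) *s axis 1 1"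
        by (simp add: vec_eq_iff forall_5 vector_5 axis_def matrix_vector_mult_def sum_UNIV_5 form_mat_nth)
      finally show ?thesis using inv(1) D(2) by (metis neg_equal_0_iff_equal)
    qed
  qed (auto intro: Gamma_int_one Gamma_int_mult)
qed

lemma first_pivot_clear:
  assumes sf: "squarefree N" and m: "m > 0" "over_m m X \<in> SO0 N" and c: "c \<noteq> 0"
    and row: "X $ 1 = c *s axis 1 1"
    and min: "\<And>A' B' j. A' \<in> Gamma_int N \<Longrightarrow> B' \<in> Gamma_int N \<Longrightarrow> (A' ** X ** B') $ 1 $ 1 = c \<Longrightarrow>
      c dvd (A' ** X ** B') $ j $ 1"
  shows "\<exists>A\<in>Gamma_int N. block_diagonal (A ** X) \<and> (A ** X)$1$1 \<noteq> 0 \<and>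
    (\<forall>i j. (A ** X)$1$1 dvd (A ** X)$i$j)"
proof -
  have N: "N > 0" by (rule squarefree_nat_pos[OF sf])
  note gen = generators_Gamma_int[OF N] swaps_Gamma_int[OF N]
  have SO: "over_m m (A ** X ** B) \<in> SO N" if "A \<in> Gamma_int N" "B \<in> Gamma_int N" for A B
    using over_m_SO0_mult[OF m(2) that] SO0_subset_SO by blast
  have X1: "X$1$1 = c" "X$1$2 = 0" "X$1$3 = 0" "X$1$4 = 0" "X$1$5 = 0"
    using row by (simp_all add: axis_def)
  have dX: "c dvd X$j$1" for j
    using min[OF Gamma_int_one Gamma_int_one, of j] X1(1) by simp
  define A0 where "A0 = eichler5 N (- (X$3$1 div c)) ** (row_lower (X$4$1 div c) ** col_upper (- (X$2$1 div c)))"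
  have A0: "A0 \<in> Gamma_int N" unfolding A0_def by (intro Gamma_int_mult gen)
  define Y where "Y = A0 ** X"
  have YSO: "over_m m Y \<in> SO N" using SO[OF A0 Gamma_int_one] by (simp add: Y_def)
  have Yrow: "Y$1$1 = c" "Y$1$2 = 0" "Y$1$3 = 0" "Y$1$4 = 0" "Y$1$5 = 0"
    by (simp_all add: Y_def A0_def matrix_mult_nth_5 eichler5_def row_lower_def col_upper_def vector_5 X1)
  have "column 1 Y = A0 *v column 1 X" by (simp add: Y_def column_mult)
  then have colY: "column 1 Y $ 2 = 0" "column 1 Y $ 3 = 0" "column 1 Y $ 4 = 0"
    using dX X1(1) by (simp_all add: A0_def generator_actions vector_5 column_def flip: matrix_vector_mul_assoc)
  have form: "Y$1$i * Y$5$j + Y$5$i * Y$1$j + Y$2$i * Y$4$j + Y$4$i * Y$2$j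
      - 2 * int N * Y$3$i * Y$3$j = (int m)\<^sup>2 * form_mat N $ i $ j" for i j
    using over_m_form[OF m(1) YSO, of i j] by (simp add: transform_form_mat)
  \<comment> \<open>Only the entry \<open>(5, 1)\<close> is left in the column; the
    \<open>(1, 1)\<close> relation of the form reads \<open>2 * c * Y$5$1 = 0\<close>.\<close>
  have Ycol: "Y$2$1 = 0" "Y$3$1 = 0" "Y$4$1 = 0" "Y$5$1 = 0"
    using colY form[of 1 1] c by (simp_all add: column_def form_mat_nth Yrow(1))
  have row5: "Y$5$2 = 0" "Y$5$3 = 0" "Y$5$4 = 0" "c * Y$5$5 = (int m)\<^sup>2"
    using form[of 1 2] form[of 1 3] form[of 1 4] form[of 1 5] c Ycol Yrow by (simp_all add: form_mat_nth)
  \<comment> \<open>The relations between columns say nothing about the last column; the first row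
    of \<open>Y\<close> times the adjoint does.\<close>
  have adj: "c * adjoint_mat N Y $ 1 $ j = 0" if "j \<noteq> 1" for j
  proof -
    have "(Y ** adjoint_mat N Y) $ 1 $ j = 0"
      using that by (simp add: adjoint_mat_right[OF sf m(1) YSO] mat_def)
    then show ?thesis by (simp add: matrix_mult_nth_5 Yrow)
  qed
  have col5: "Y$2$5 = 0" "Y$3$5 = 0" "Y$4$5 = 0"
    using adj[of 2] adj[of 3] adj[of 4] c N by (simp_all add: adjoint_mat_def Let_def vector_5)
  have blk: "block_diagonal Y"
    using Yrow Ycol row5 col5 by (simp add: block_diagonal_def forall_5)
  have minY: "c dvd (Y ** B') $ j $ 1" if "B' \<in> Gamma_int N" "(Y ** B') $ 1 $ 1 = c" for B' j
    using min[OF A0 that(1), of j] that(2) by (simp add: Y_def)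
  \<comment> \<open>The first columns of \<open>col_upper 1\<close>, \<open>row_lower 1\<close> and
    \<open>eichler5 N 1\<close> are the three isotropic test vectors. Each leaves the
    \<open>(1, 1)\<close> entry equal to \<open>c\<close>, so the divisibility given by minimality
    applies to the modified first column.\<close>
  have d2: "c dvd Y$j$2" for j
    using minY[OF gen(3)[of 1], of j] Yrow Ycol exhaust_5[of j]
    by (auto simp: matrix_mult_nth_5 col_upper_def vector_5)
  have d4: "c dvd Y$j$4" for j
    using minY[OF gen(2)[of 1], of j] Yrow Ycol exhaust_5[of j]
    by (auto simp: matrix_mult_nth_5 row_lower_def vector_5)
  have d3: "c dvd Y$j$3" for j
    using minY[OF gen(5)[of 1], of j] Yrow Ycol row5 col5 exhaust_5[of j]
    by (auto simp: matrix_mult_nth_5 eichler5_def vector_5)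
  \<comment> \<open>This is the \<open>(2, 4)\<close> entry of the form relation, equal to
    \<open>m^2 = c * Y$5$5\<close>; every product contains one entry from column 2 and one from
    column 4.\<close>
  have "c * c dvd Y$2$2 * Y$4$4 + Y$4$2 * Y$2$4 - 2 * int N * (Y$3$2 * Y$3$4)"
    by (intro dvd_diff dvd_add dvd_mult mult_dvd_mono d2 d4)
  then have "c * c dvd c * Y$5$5"
    using form[of 2 4] Yrow row5 by (simp add: form_mat_nth mult.assoc)
  then have d5: "c dvd Y$5$5" using c by simp
  have "c dvd Y$i$j" for i j
    using exhaust_5[of j] exhaust_5[of i] d2 d3 d4 d5 col5 Yrow Ycol by auto
  then have "block_diagonal Y \<and> Y$1$1 \<noteq> 0 \<and> (\<forall>i j. Y$1$1 dvd Y$i$j)"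
    using blk c Yrow(1) by simp
  then show ?thesis
    unfolding Y_def by (rule bexI[OF _ A0])
qed

lemma first_pivot:
  assumes sf: "squarefree N" and m: "m > 0" "over_m m M \<in> SO0 N"
  shows "\<exists>A\<in>Gamma_int N. \<exists>B\<in>Gamma_int N. block_diagonal (A ** M ** B) \<and> (A ** M ** B)$1$1 \<noteq> 0 \<and>
    (\<forall>i j. (A ** M ** B)$1$1 dvd (A ** M ** B)$i$j)"
proof -
  obtain A B c where A: "A \<in> Gamma_int N" and B: "B \<in> Gamma_int N" and c: "c \<noteq> 0"
    and row: "(A ** M ** B) $ 1 = c *s axis 1 1"
    and min: "\<forall>A'\<in>Gamma_int N. \<forall>B'\<in>Gamma_int N. (A' ** (A ** M ** B) ** B') $ 1 $ 1 = c \<longrightarrow>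
      (\<forall>j. c dvd (A' ** (A ** M ** B) ** B') $ j $ 1)"
    using first_pivot_row[OF assms] by blast
  obtain A0 where A0: "A0 \<in> Gamma_int N" "block_diagonal (A0 ** (A ** M ** B)) \<and>
      (A0 ** (A ** M ** B))$1$1 \<noteq> 0 \<and>
      (\<forall>i j. (A0 ** (A ** M ** B))$1$1 dvd (A0 ** (A ** M ** B))$i$j)"
    using first_pivot_clear[OF sf m(1) over_m_SO0_mult[OF m(2) A B] c row] min by blast
  have "A0 ** (A ** M ** B) = (A0 ** A) ** M ** B" by (simp add: matrix_mul_assoc)
  then show ?thesis using A0(2) Gamma_int_mult[OF A0(1) A] B by metis
qed

section \<open>The pivot of the middle block\<close>

lemma second_pivot_row:
  assumes sf: "squarefree N" and m: "m > 0" "over_m m M \<in> SO0 N" and blk: "block_diagonal M"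
  shows "\<exists>A\<in>Gamma_levi N. \<exists>B\<in>Gamma_levi N. \<exists>c. c \<noteq> 0 \<and> (A ** M ** B) $ 2 = c *s axis 2 1 \<and>
    (\<forall>A'\<in>Gamma_levi N. \<forall>B'\<in>Gamma_levi N. (A' ** (A ** M ** B) ** B') $ 2 $ 2 = c \<longrightarrow>
      (\<forall>j. c dvd (A' ** (A ** M ** B) ** B') $ j $ 2))"
proof -
  have N: "N > 0" by (rule squarefree_nat_pos[OF sf])
  have LG: "A \<in> Gamma_int N" if "A \<in> Gamma_levi N" for A
    using that by (simp add: Gamma_levi_def)
  have SO: "over_m m (A ** M ** B) \<in> SO N" if "A \<in> Gamma_levi N" "B \<in> Gamma_levi N" for A B
    using over_m_SO0_mult[OF m(2) LG LG] that SO0_subset_SO by blast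
  show ?thesis
  proof (rule minimal_pivot)
    show "\<exists>A'. A' ** A = mat 1 \<and> A ** A' = mat 1" if "A \<in> Gamma_levi N" for A
      using Gamma_int_inverse[OF sf LG[OF that]] by blast
    show "\<exists>C\<in>Gamma_levi N. \<exists>c. c \<noteq> 0 \<and> C *v column 2 (A ** M ** B) = c *s axis 2 1"
      if "A \<in> Gamma_levi N" "B \<in> Gamma_levi N" for A B
    proof -
      have "vector [0, c, 0, 0, 0] = c *s (axis 2 1 :: int^5)" for c
        by (simp add: vec_eq_iff forall_5 vector_5 axis_def)
      moreover have "column 2 (A ** M ** B) $ 1 = 0" "column 2 (A ** M ** B) $ 5 = 0"
        using block_diagonal_levi(1)[OF blk that] by (simp_all add: column_def block_diagonal_def)
      ultimately show ?thesis
        using levi_orbit[OF sf column_isotropic(1)[OF sf m(1) SO[OF that], of 2]]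
          column_isotropic(2)[OF sf m(1) SO[OF that], of 2] by auto
    qed
    show "\<exists>C\<in>Gamma_levi N. \<exists>c. c \<noteq> 0 \<and> (A ** M ** B ** C) $ 2 = c *s axis 2 1"
      if AB: "A \<in> Gamma_levi N" "B \<in> Gamma_levi N" for A B
    proof -
      let ?X = "A ** M ** B"
      note dr = dual_row[OF sf m(1) SO[OF AB], of 2]
      have "dual_row N ?X 2 $ 1 = 0" "dual_row N ?X 2 $ 5 = 0"
        using block_diagonal_levi(1)[OF blk AB] by (simp_all add: dual_row_def vector_5 block_diagonal_def)
      then obtain D c where D: "D \<in> Gamma_levi N" "c \<noteq> 0" "D *v dual_row N ?X 2 = vector [0, c, 0, 0, 0]"
        using levi_orbit[OF sf dr(2) _ _ dr(3)] by auto
      \<comment> \<open>The Gram matrix exchanges \<open>e2\<close> and \<open>e4\<close>, so the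
        dual vector must be moved to the \<open>e4\<close> axis.\<close>
      define E where "E = levi_swap ** D"
      have E: "E \<in> Gamma_levi N"
        using D(1) levi_swap_Gamma_levi[OF N] by (simp add: E_def Gamma_levi_mult)
      have Ev: "E *v dual_row N ?X 2 = vector [0, 0, 0, c, 0]"
        unfolding E_def matrix_vector_mul_assoc[symmetric] D(3)
        by (simp add: levi_swap_def matrix_5_simps)
      note inv = Gamma_int_inverse[OF sf LG[OF E]]
      have "dual_row N ?X 2 = adjoint_mat N E *v vector [0, 0, 0, c, 0]"
        by (metis Ev inv(2) matrix_vector_mul_assoc matrix_vector_mul_lid)
      then have "(?X ** adjoint_mat N E) $ 2 = form_mat N *v vector [0, 0, 0, c, 0]"
        using row_mult_Gamma_int[OF inv(1)] dr(1) by simp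
      also have "\<dots> = c *s axis 2 1"
        by (simp add: vec_eq_iff forall_5 vector_5 axis_def matrix_vector_mult_def sum_UNIV_5 form_mat_nth)
      finally show ?thesis using Gamma_levi_inverse[OF sf E] D(2) by metis
    qed
  qed (auto intro: Gamma_levi_one Gamma_levi_mult)
qed

lemma second_pivot_clear:
  assumes sf: "squarefree N" and m: "m > 0" "over_m m X \<in> SO0 N" and blk: "block_diagonal X" and c: "c \<noteq> 0"
    and row: "X $ 2 = c *s axis 2 1"
    and min: "\<And>A' B' j. A' \<in> Gamma_levi N \<Longrightarrow> B' \<in> Gamma_levi N \<Longrightarrow> (A' ** X ** B') $ 2 $ 2 = c \<Longrightarrow>
      c dvd (A' ** X ** B') $ j $ 2"
  shows "\<exists>A\<in>Gamma_levi N. \<exists>c p d. c \<noteq> 0 \<and> c * d = (int m)\<^sup>2 \<and> p\<^sup>2 = (int m)\<^sup>2 \<and> c dvd p \<and>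
    A ** X = vector [vector [X$1$1, 0, 0, 0, 0], vector [0, c, 0, 0, 0], vector [0, 0, p, 0, 0],
      vector [0, 0, 0, d, 0], vector [0, 0, 0, 0, X$5$5]]"
proof -
  have N: "N > 0" by (rule squarefree_nat_pos[OF sf])
  note gen = eichler_Gamma_levi[OF N]
  have LG: "A \<in> Gamma_int N" if "A \<in> Gamma_levi N" for A
    using that by (simp add: Gamma_levi_def)
  have X2: "X$2$2 = c" "X$2$1 = 0" "X$2$3 = 0" "X$2$4 = 0" "X$2$5 = 0"
    using row by (simp_all add: axis_def)
  have dX: "c dvd X$j$2" for j
    using min[OF Gamma_levi_one Gamma_levi_one, of j] X2(1) by simp
  define A0 where "A0 = eichler4 N (- (X$3$2 div c))"
  have A0: "A0 \<in> Gamma_levi N" unfolding A0_def by (rule gen)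
  define Y where "Y = A0 ** X"
  have YSO: "over_m m Y \<in> SO N"
    using over_m_SO0_mult[OF m(2) LG[OF A0] Gamma_int_one] SO0_subset_SO[of N] by (auto simp: Y_def)
  have blkY: "block_diagonal Y" "Y$1$1 = X$1$1" "Y$5$5 = X$5$5"
    using block_diagonal_levi[OF blk A0 Gamma_levi_one] by (simp_all add: Y_def)
  note blk' = blkY(1)[unfolded block_diagonal_def forall_5, simplified]
  have Yrow: "Y$2$2 = c" "Y$2$3 = 0" "Y$2$4 = 0"
    by (simp_all add: Y_def A0_def matrix_mult_nth_5 eichler4_def vector_5 X2)
  have "column 2 Y = A0 *v column 2 X" by (simp add: Y_def column_mult)
  then have "column 2 Y $ 3 = 0"
    using dX X2(1) by (simp add: A0_def generator_actions vector_5 column_def)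
  then have Y32: "Y$3$2 = 0" by (simp add: column_def)
  have form: "Y$1$i * Y$5$j + Y$5$i * Y$1$j + Y$2$i * Y$4$j + Y$4$i * Y$2$j
      - 2 * int N * Y$3$i * Y$3$j = (int m)\<^sup>2 * form_mat N $ i $ j" for i j
    using over_m_form[OF m(1) YSO, of i j] by (simp add: transform_form_mat)
  have Y42: "Y$4$2 = 0"
    using form[of 2 2] c Y32 blk' by (simp add: form_mat_nth Yrow)
  have row4: "Y$4$3 = 0" "c * Y$4$4 = (int m)\<^sup>2"
    using form[of 2 3] form[of 2 4] c Y32 Y42 Yrow blk' by (simp_all add: form_mat_nth)
  have "(Y ** adjoint_mat N Y) $ 2 $ 3 = 0"
    by (simp add: adjoint_mat_right[OF sf m(1) YSO] mat_def)
  then have "c * adjoint_mat N Y $ 2 $ 3 = 0"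
    using Yrow blk' by (simp add: matrix_mult_nth_5)
  then have Y34: "Y$3$4 = 0"
    using c N by (simp add: adjoint_mat_def Let_def vector_5)
  have p: "(Y$3$3)\<^sup>2 = (int m)\<^sup>2"
  proof -
    have "2 * int N * (Y$3$3)\<^sup>2 = 2 * int N * (int m)\<^sup>2"
      using form[of 3 3] row4 Yrow blk' by (simp add: form_mat_nth power2_eq_square mult.assoc mult.left_commute)
    then show ?thesis using N by simp
  qed
  \<comment> \<open>The second column of \<open>eichler4 N 1\<close> is
    \<open>e2 + e3 + N e4\<close>, which brings \<open>Y$3$3\<close> into the second column without
    changing the pivot.\<close>
  have "(Y ** eichler4 N 1) $ 2 $ 2 = c"
    by (simp add: matrix_mult_nth_5 eichler4_def vector_5 Yrow)
  then have "c dvd (Y ** eichler4 N 1) $ 3 $ 2"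
    using min[OF A0 gen(1)[of 1], of 3] by (simp add: Y_def)
  then have "c dvd Y$3$3"
    by (simp add: matrix_mult_nth_5 eichler4_def vector_5 Y32 Y34 blk')
  moreover have "Y = vector [vector [X$1$1, 0, 0, 0, 0], vector [0, c, 0, 0, 0], vector [0, 0, Y$3$3, 0, 0],
      vector [0, 0, 0, Y$4$4, 0], vector [0, 0, 0, 0, X$5$5]]"
    using blk' blkY Yrow Y32 Y42 row4 Y34 by (simp add: vec_eq_iff forall_5 vector_5)
  ultimately have "\<exists>c p d. c \<noteq> 0 \<and> c * d = (int m)\<^sup>2 \<and> p\<^sup>2 = (int m)\<^sup>2 \<and> c dvd p \<and>
    Y = vector [vector [X$1$1, 0, 0, 0, 0], vector [0, c, 0, 0, 0], vector [0, 0, p, 0, 0],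
      vector [0, 0, 0, d, 0], vector [0, 0, 0, 0, X$5$5]]"
    using c row4(2) p by blast
  then show ?thesis
    unfolding Y_def by (rule bexI[OF _ A0])
qed

lemma second_pivot:
  assumes sf: "squarefree N" and m: "m > 0" "over_m m M \<in> SO0 N" and blk: "block_diagonal M"
  shows "\<exists>A\<in>Gamma_levi N. \<exists>B\<in>Gamma_levi N. \<exists>c p d. c \<noteq> 0 \<and> c * d = (int m)\<^sup>2 \<and> p\<^sup>2 = (int m)\<^sup>2 \<and> c dvd p \<and>
    A ** M ** B = vector [vector [M$1$1, 0, 0, 0, 0], vector [0, c, 0, 0, 0], vector [0, 0, p, 0, 0],
      vector [0, 0, 0, d, 0], vector [0, 0, 0, 0, M$5$5]]"
proof -
  obtain A B c where A: "A \<in> Gamma_levi N" and B: "B \<in> Gamma_levi N" and c: "c \<noteq> 0"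
    and row: "(A ** M ** B) $ 2 = c *s axis 2 1"
    and min: "\<forall>A'\<in>Gamma_levi N. \<forall>B'\<in>Gamma_levi N. (A' ** (A ** M ** B) ** B') $ 2 $ 2 = c \<longrightarrow>
      (\<forall>j. c dvd (A' ** (A ** M ** B) ** B') $ j $ 2)"
    using second_pivot_row[OF assms] by blast
  have AB: "A \<in> Gamma_int N" "B \<in> Gamma_int N" using A B by (auto simp: Gamma_levi_def)
  note blkX = block_diagonal_levi[OF blk A B]
  obtain A0 where A0: "A0 \<in> Gamma_levi N"
    and ex: "\<exists>c p d. c \<noteq> 0 \<and> c * d = (int m)\<^sup>2 \<and> p\<^sup>2 = (int m)\<^sup>2 \<and> c dvd p \<and>
      A0 ** (A ** M ** B) = vector [vector [M$1$1, 0, 0, 0, 0], vector [0, c, 0, 0, 0], vector [0, 0, p, 0, 0],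
        vector [0, 0, 0, d, 0], vector [0, 0, 0, 0, M$5$5]]"
    using second_pivot_clear[OF sf m(1) over_m_SO0_mult[OF m(2) AB] blkX(1) c row] min
    unfolding blkX(2,3) by blast
  have "A0 ** (A ** M ** B) = (A0 ** A) ** M ** B" by (simp add: matrix_mul_assoc)
  then show ?thesis using ex Gamma_levi_mult[OF A0 A] B by metis
qed

section \<open>The sign of the positive definite part\<close>

definition positive_block :: "real^5^5 \<Rightarrow> real" where
  "positive_block x = (x$1$1 + x$1$5 + x$5$1 + x$5$5) * (x$2$2 + x$2$4 + x$4$2 + x$4$4)
     - (x$1$2 + x$1$4 + x$5$2 + x$5$4) * (x$2$1 + x$2$5 + x$4$1 + x$4$5)"

text \<open>Up to a factor this is the determinant of the compression of \<open>x\<close> to the positive definite plane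
  spanned by \<open>e\<^sub>1 + e\<^sub>5\<close> and \<open>e\<^sub>2 + e\<^sub>4\<close>. A kernel vector of the compression would be mapped by \<open>x\<close> into the
  negative definite complement.\<close>

lemma positive_block_nonzero:
  assumes "x \<in> SO N"
  shows "positive_block x \<noteq> 0"
proof
  assume z: "positive_block x = 0"
  define p q r s where "p = x$1$1 + x$1$5 + x$5$1 + x$5$5" "q = x$1$2 + x$1$4 + x$5$2 + x$5$4"
    "r = x$2$1 + x$2$5 + x$4$1 + x$4$5" "s = x$2$2 + x$2$4 + x$4$2 + x$4$4"
  note d = this
  have ps: "p * s - q * r = 0" using z by (simp add: positive_block_def d)
  obtain a b where ab: "p * a + q * b = 0" "r * a + s * b = 0" "a\<^sup>2 + b\<^sup>2 > 0"
  proof (cases "p = 0 \<and> q = 0")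
    case True
    show ?thesis
    proof (cases "r = 0 \<and> s = 0")
      case True
      with \<open>p = 0 \<and> q = 0\<close> show ?thesis using that[of 1 0] by simp
    next
      case False
      with \<open>p = 0 \<and> q = 0\<close> show ?thesis using that[of s "- r"] by (auto simp: sum_power2_gt_zero_iff)
    qed
  next
    case False
    then show ?thesis using that[of q "- p"] ps by (simp add: sum_power2_gt_zero_iff algebra_simps)
  qed
  \<comment> \<open>The image under \<open>x\<close> of \<open>a (e1 + e5) + b (e2 + e4)\<close>.
    The choice of \<open>a\<close> and \<open>b\<close> says that \<open>y 1 + y 5\<close> and
    \<open>y 2 + y 4\<close> vanish, so \<open>q\<close> is at most 0 there, although it must equal
    \<open>a^2 + b^2\<close>.\<close>
  define y where "y i = a * (x$i$1 + x$i$5) + b * (x$i$2 + x$i$4)" for i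
  have y: "y 5 = - y 1" "y 4 = - y 2"
    using ab(1,2) by (simp_all add: y_def d algebra_simps)
  have "transform (form_mat N) x = form_mat N" using assms by (simp add: SO_iff)
  then have f: "x$1$i * x$5$j + x$5$i * x$1$j + x$2$i * x$4$j + x$4$i * x$2$j
      - 2 * real N * x$3$i * x$3$j = form_mat N $ i $ j" for i j
    by (metis transform_form_mat)
  have "2 * (y 1 * y 5 + y 2 * y 4 - real N * (y 3)\<^sup>2) = 
    a * a * (form_mat N $ 1 $ 1 + form_mat N $ 1 $ 5 + form_mat N $ 5 $ 1 + form_mat N $ 5 $ 5)
    + a * b * (form_mat N $ 1 $ 2 + form_mat N $ 1 $ 4 + form_mat N $ 5 $ 2 + form_mat N $ 5 $ 4)
    + a * b * (form_mat N $ 2 $ 1 + form_mat N $ 2 $ 5 + form_mat N $ 4 $ 1 + form_mat N $ 4 $ 5)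
    + b * b * (form_mat N $ 2 $ 2 + form_mat N $ 2 $ 4 + form_mat N $ 4 $ 2 + form_mat N $ 4 $ 4)"
    unfolding f[symmetric] y_def power2_eq_square by algebra
  also have "\<dots> = 2 * (a\<^sup>2 + b\<^sup>2)"
    by (simp add: form_mat_def vector_5 power2_eq_square)
  finally have "a\<^sup>2 + b\<^sup>2 = - (y 1)\<^sup>2 - (y 2)\<^sup>2 - real N * (y 3)\<^sup>2"
    by (simp add: y power2_eq_square)
  moreover have "real N * (y 3)\<^sup>2 \<ge> 0" by simp
  ultimately show False using ab(3) by (smt (verit) zero_le_power2)
qed

text \<open>A continuous function without zeros on a connected set keeps the sign that it has at the
  identity.\<close>

lemma positive_block_SO0:
  assumes "x \<in> SO0 N"
  shows "positive_block x > 0"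
proof (rule ccontr)
  assume neg: "\<not> positive_block x > 0"
  have "connected (positive_block ` SO0 N)"
    unfolding positive_block_def
    by (intro connected_continuous_image continuous_intros connected_SO0)
  moreover have "positive_block (mat 1) \<in> positive_block ` SO0 N" "positive_block x \<in> positive_block ` SO0 N"
    using one_in_SO0 assms by blast+
  moreover have "positive_block (mat 1) = 4"
    by (simp add: positive_block_def mat_def)
  ultimately have "0 \<in> positive_block ` SO0 N"
    using neg connectedD_interval[of "positive_block ` SO0 N" "positive_block x" 4 0] by simp
  then show False using positive_block_nonzero SO0_subset_SO by fastforce
qed

section \<open>Uniqueness of the Smith normal form\<close>

text \<open>Counting solutions of \<open>D x \<equiv> 0\<close> modulo \<open>n\<close> separates Smith normal forms.\<close>

definition kernel_mod :: "nat \<Rightarrow> int^5^5 \<Rightarrow> (int^5) set" where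
  "kernel_mod n M = {x. \<forall>i. 0 \<le> x$i \<and> x$i < int n \<and> int n dvd (M *v x) $ i}"

text \<open>With \<open>g\<close> the gcd, the solutions are the \<open>g\<close> multiples of
  \<open>n div g\<close> in the range.\<close>

lemma card_dvd_mult:
  assumes "n > 0"
  shows "card {x::int. 0 \<le> x \<and> x < int n \<and> int n dvd int d * x} = gcd d n"
proof -
  define g where "g = gcd d n"
  have g: "g > 0" "g dvd n" using assms by (auto simp: g_def)
  define k where "k = n div g"
  have n: "n = g * k" using g by (simp add: k_def)
  have k: "k > 0" using n assms by (cases k) auto
  obtain e where e: "d = g * e" "coprime e k"
    by (metis assms div_gcd_coprime dvd_div_mult_self g_def gcd_dvd1 k_def less_irrefl mult.commute)
  have "{x::int. 0 \<le> x \<and> x < int n \<and> int n dvd int d * x} = (\<lambda>j. int (k * j)) ` {..<g}"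
  proof (intro equalityI subsetI)
    fix x assume "x \<in> {x::int. 0 \<le> x \<and> x < int n \<and> int n dvd int d * x}"
    then have x: "0 \<le> x" "x < int n" "int n dvd int d * x" by auto
    have "int k dvd int e * x" using x(3) g(1) by (simp add: n e mult.assoc)
    then have "int k dvd x" using e(2) by (simp add: coprime_dvd_mult_right_iff coprime_commute)
    then obtain j where j: "x = int k * j" by blast
    then have "0 \<le> j" "j < int g" using x k by (auto simp: n zero_le_mult_iff)
    then show "x \<in> (\<lambda>j. int (k * j)) ` {..<g}"
      using j by (intro image_eqI[of _ _ "nat j"]) auto
  next
    fix x assume "x \<in> (\<lambda>j. int (k * j)) ` {..<g}"
    then show "x \<in> {x::int. 0 \<le> x \<and> x < int n \<and> int n dvd int d * x}"
      using k by (auto simp: n e zero_le_mult_iff)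
  qed
  moreover have "inj_on (\<lambda>j. int (k * j)) {..<g}" using k by (auto simp: inj_on_def)
  ultimately show ?thesis by (simp add: card_image g_def)
qed

lemma card_vec_box:
  fixes B :: "'n::finite \<Rightarrow> 'a set"
  shows "card {x::'a^'n. \<forall>i. x$i \<in> B i} = (\<Prod>i\<in>UNIV. card (B i))"
proof -
  have "bij_betw vec_nth {x::'a^'n. \<forall>i. x$i \<in> B i} (PiE UNIV B)"
    by (rule bij_betwI[where g = vec_lambda]) auto
  then show ?thesis by (simp add: bij_betw_same_card card_PiE)
qed

lemma card_kernel_mod_diag:
  assumes "n > 0"
  shows "card (kernel_mod n (diag_mat d)) = (\<Prod>i\<in>UNIV. gcd (d$i) n)"
proof -
  have "(diag_mat d *v x) $ i = int (d$i) * x$i" for x i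
    by (simp add: diag_mat_def matrix_vector_mult_def if_distrib[of "\<lambda>a. a * _"] cong: if_cong)
  then have "kernel_mod n (diag_mat d) = {x. \<forall>i. x$i \<in> {x. 0 \<le> x \<and> x < int n \<and> int n dvd int (d$i) * x}}"
    by (auto simp: kernel_mod_def)
  then show ?thesis by (simp only: card_vec_box card_dvd_mult[OF assms])
qed

lemma finite_kernel_mod: "finite (kernel_mod n M)"
proof (rule finite_subset)
  show "kernel_mod n M \<subseteq> {x. \<forall>i. x$i \<in> {0..<int n}}" by (auto simp: kernel_mod_def)
  show "finite {x :: int^5. \<forall>i. x$i \<in> {0..<int n}}"
  proof (rule finite_subset)
    show "{x :: int^5. \<forall>i. x$i \<in> {0..<int n}} \<subseteq> vec_lambda ` (PiE UNIV (\<lambda>_. {0..<int n}))"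
      by (auto intro!: image_eqI[of _ _ "vec_nth _"])
    show "finite (vec_lambda ` (PiE UNIV (\<lambda>_. {0..<int n})) :: (int^5) set)"
      by (intro finite_imageI finite_PiE) auto
  qed
qed

text \<open>The map \<open>x\<close> to \<open>V x\<close> modulo \<open>n\<close> is injective
  because \<open>V\<close> has an integral inverse, and it lands in the kernel of \<open>M\<close>
  because \<open>U\<close> can be cancelled. Reduction picks the representatives in
  \<open>[0, n)\<close>.\<close>

lemma card_kernel_mod_le:
  assumes n: "n > 0" and "invertible U" "invertible V"
  shows "card (kernel_mod n (U ** M ** V)) \<le> card (kernel_mod n M)"
proof (rule card_inj_on_le)
  let ?r = "\<lambda>x::int^5. \<chi> i. x$i mod int n"
  obtain U' V' where U': "U' ** U = mat 1" and V': "V' ** V = mat 1"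
    using assms by (auto simp: invertible_def)
  have lin: "int n dvd (A *v x) $ i" if "\<And>j. int n dvd x $ j" for A :: "int^5^5" and x i
    using that by (auto simp: matrix_vector_mult_def intro!: dvd_sum)
  have cong: "int n dvd (A *v ?r x) $ i \<longleftrightarrow> int n dvd (A *v x) $ i" for A :: "int^5^5" and x i
  proof -
    have "int n dvd (A *v (x - ?r x)) $ i"
      by (rule lin) (simp add: minus_mod_eq_mult_div)
    moreover have "(A *v x) $ i = (A *v (x - ?r x)) $ i + (A *v ?r x) $ i"
      by (simp add: matrix_vector_mult_def algebra_simps flip: sum.distrib)
    ultimately show ?thesis by (simp add: dvd_add_right_iff)
  qed
  show "inj_on (\<lambda>x. ?r (V *v x)) (kernel_mod n (U ** M ** V))"
  proof (rule inj_onI)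
    fix x y assume x: "x \<in> kernel_mod n (U ** M ** V)" and y: "y \<in> kernel_mod n (U ** M ** V)"
      and eq: "?r (V *v x) = ?r (V *v y)"
    have "int n dvd (V *v x) $ j - (V *v y) $ j" for j
      using eq by (simp add: vec_eq_iff mod_eq_dvd_iff)
    then have "int n dvd (V' *v (V *v x - V *v y)) $ i" for i
      by (intro lin) simp
    moreover have "V' *v (V *v x - V *v y) = x - y"
    proof -
      have "V' *v (V *v x - V *v y) = V' *v (V *v x) - V' *v (V *v y)"
        by (simp add: vec_eq_iff matrix_vector_mult_def sum_subtractf right_diff_distrib)
      then show ?thesis by (simp add: matrix_vector_mul_assoc V')
    qed
    ultimately have d: "int n dvd x$i - y$i" for i by (metis vector_minus_component)
    have "x$i = y$i" for i
    proof -
      have "\<bar>x$i - y$i\<bar> < int n" using x y by (auto simp: kernel_mod_def abs_less_iff) (smt (verit))+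
      moreover have "\<bar>int n\<bar> \<le> \<bar>x$i - y$i\<bar>" if "x$i \<noteq> y$i"
        using that d[of i] by (intro dvd_imp_le_int) auto
      ultimately show ?thesis by fastforce
    qed
    then show "x = y" by (simp add: vec_eq_iff)
  qed
  show "(\<lambda>x. ?r (V *v x)) ` kernel_mod n (U ** M ** V) \<subseteq> kernel_mod n M"
  proof clarify
    fix x assume "x \<in> kernel_mod n (U ** M ** V)"
    then have "int n dvd ((U ** M ** V) *v x) $ j" for j by (simp add: kernel_mod_def)
    then have "int n dvd (U' *v ((U ** M ** V) *v x)) $ i" for i by (rule lin)
    moreover have "U' *v ((U ** M ** V) *v x) = M *v (V *v x)"
      by (metis U' matrix_mul_assoc matrix_mul_lid matrix_vector_mul_assoc)
    ultimately have "int n dvd (M *v (V *v x)) $ i" for i by metis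
    then show "?r (V *v x) \<in> kernel_mod n M"
      using n by (simp only: kernel_mod_def mem_Collect_eq cong) simp
  qed
qed (rule finite_kernel_mod)

lemma invertible_inverse:
  assumes "invertible U"
  obtains U' where "invertible U'" "U' ** U = mat 1" "U ** U' = mat 1"
  using assms unfolding invertible_def by blast

lemma card_kernel_mod_eq:
  fixes M :: "int^5^5"
  assumes n: "n > 0" and U: "invertible U" and V: "invertible V"
  shows "card (kernel_mod n (U ** M ** V)) = card (kernel_mod n M)"
proof (rule antisym)
  obtain U' V' where i: "invertible U'" "U' ** U = mat 1" "invertible V'" "V ** V' = mat 1"
    using U V by (metis invertible_inverse)
  have "U' ** (U ** M ** V) ** V' = (U' ** U) ** M ** (V ** V')"
    by (simp add: matrix_mul_assoc)
  also have "\<dots> = M" by (simp add: i)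
  finally show "card (kernel_mod n M) \<le> card (kernel_mod n (U ** M ** V))"
    using card_kernel_mod_le[OF n i(1) i(3), of "U ** M ** V"] by simp
qed (rule card_kernel_mod_le[OF assms])

lemma prod_list_gcd_le:
  assumes "\<forall>x\<in>set l. (0::nat) < x"
  shows "(\<Prod>x\<leftarrow>l. gcd x n) \<le> prod_list l"
  using assms by (induction l) (auto intro!: mult_le_mono gcd_le1_nat)

text \<open>Each factor on the right is at most the corresponding entry, so a strict loss at the
  head could not be made up by the tail.\<close>

lemma prod_list_gcd_eq_imp_dvd:
  fixes e n :: nat
  assumes "\<forall>x\<in>set (e # l). 0 < x" "prod_list (e # l) \<le> (\<Prod>x\<leftarrow>e # l. gcd x n)"
  shows "e dvd n"
proof (rule ccontr)
  assume "\<not> e dvd n"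
  then have "gcd e n < e" using assms(1) by (metis gcd_dvd2 gcd_le1_nat le_neq_implies_less list.set_intros(1) not_gr0)
  moreover have "0 < prod_list l" using assms(1) by (induction l) auto
  ultimately have "gcd e n * prod_list l < e * prod_list l" by (metis mult_less_mono1)
  moreover have "gcd e n * (\<Prod>x\<leftarrow>l. gcd x n) \<le> gcd e n * prod_list l"
    using prod_list_gcd_le[of l n] assms(1) by simp
  ultimately show False using assms(2) by (simp only: list.map prod_list.Cons)
qed

lemma prod_list_gcd_self:
  "\<forall>x\<in>set l. x dvd d \<Longrightarrow> (\<Prod>x\<leftarrow>l. gcd x d) = prod_list (l :: nat list)"
  by (induction l) (auto simp: gcd_nat.absorb1)

text \<open>The head is a multiple of the whole list. Evaluating at \<open>n = d\<close> gives the
  full product of the first list, evaluating at \<open>n = d'\<close> that of the second; so the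
  products agree and the heads divide each other. The common positive factor \<open>gcd d n\<close>
  then cancels and the tails can be compared.\<close>

lemma divisor_chain_unique:
  fixes l l' :: "nat list"
  assumes "length l = length l'" "sorted_wrt (\<lambda>a b. b dvd a) l" "sorted_wrt (\<lambda>a b. b dvd a) l'"
    "\<forall>x\<in>set l. 0 < x" "\<forall>x\<in>set l'. 0 < x"
    "\<And>n. n > 0 \<Longrightarrow> (\<Prod>x\<leftarrow>l. gcd x n) = (\<Prod>x\<leftarrow>l'. gcd x n)"
  shows "l = l'"
  using assms
proof (induction l l' rule: list_induct2)
  case (Cons d l d' l')
  have a: "prod_list (d # l) = (\<Prod>x\<leftarrow>d' # l'. gcd x d)"
    using Cons.prems(1,3) Cons.prems(5)[of d] prod_list_gcd_self[of "d # l" d] by simp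
  have b: "prod_list (d' # l') = (\<Prod>x\<leftarrow>d # l. gcd x d')"
    using Cons.prems(2,4) Cons.prems(5)[of d'] prod_list_gcd_self[of "d' # l'" d'] by simp
  have ab: "prod_list (d # l) \<le> prod_list (d' # l')"
    by (subst a) (rule prod_list_gcd_le[OF Cons.prems(4)])
  have ba: "prod_list (d' # l') \<le> prod_list (d # l)"
    by (subst b) (rule prod_list_gcd_le[OF Cons.prems(3)])
  have "d dvd d'"
    using prod_list_gcd_eq_imp_dvd[OF Cons.prems(3)] ab unfolding b .
  moreover have "d' dvd d"
    using prod_list_gcd_eq_imp_dvd[OF Cons.prems(4)] ba unfolding a .
  ultimately have eq: "d = d'" by (rule dvd_antisym)
  have "(\<Prod>x\<leftarrow>l. gcd x n) = (\<Prod>x\<leftarrow>l'. gcd x n)" if "n > 0" for n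
    using Cons.prems(5)[OF that] that by (simp add: eq)
  then show ?case using Cons eq by simp
qed simp

text \<open>The description operator in \<open>smith_invariants\<close> ranges over all normal
  forms, also those with zero entries. A nonzero determinant of \<open>M\<close> excludes these
  before the counting argument.\<close>

lemma smith_normal_form_unique:
  assumes d: "smith_normal_form M d" "\<forall>i. 0 < d$i" and d': "smith_normal_form M d'"
  shows "d = d'"
proof -
  have unit: "det U \<noteq> 0" if "invertible U" for U :: "int^5^5"
  proof -
    obtain U' where "U ** U' = mat 1" using \<open>invertible U\<close> by (auto simp: invertible_def)
    then have "det U * det U' = 1" by (metis det_I det_mul)
    then show ?thesis by auto
  qed
  have det: "det (diag_mat d) \<noteq> 0 \<longleftrightarrow> det M \<noteq> 0" if "smith_normal_form M d" for d
  proof -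
    obtain U V where "invertible U" "invertible V" "U ** M ** V = diag_mat d"
      using \<open>smith_normal_form M d\<close> by (auto simp: smith_normal_form_def)
    then show ?thesis using unit by (metis det_mul mult_eq_0_iff)
  qed
  have prod: "det (diag_mat d) = (\<Prod>i\<in>UNIV. int (d$i))" for d
    by (subst det_diagonal) (simp_all add: diag_mat_def)
  have "\<forall>i. 0 < d'$i"
    using det[OF d(1)] det[OF d'] d(2) by (auto simp: prod)
  note d' = d' this
  \<comment> \<open>Listed from the last invariant down, so that the head is divisible by all the
    others.\<close>
  define l where "l d = [d$5, d$4, d$3, d$2, d$1]" for d :: "nat^5"
  have c: "card (kernel_mod n M) = (\<Prod>x\<leftarrow>l d. gcd x n)" if "smith_normal_form M d" "n > 0" for d n
  proof -
    obtain U V where UV: "invertible U" "invertible V" "U ** M ** V = diag_mat d"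
      using \<open>smith_normal_form M d\<close> by (auto simp: smith_normal_form_def)
    have "card (kernel_mod n M) = (\<Prod>i\<in>UNIV. gcd (d$i) n)"
      using card_kernel_mod_eq[OF \<open>n > 0\<close> UV(1,2), of M] card_kernel_mod_diag[OF \<open>n > 0\<close>, of d]
      by (simp add: UV(3))
    also have "(UNIV :: 5 set) = {1, 2, 3, 4, 5}" using exhaust_5 by auto
    finally show ?thesis by (simp add: l_def ac_simps)
  qed
  have s: "sorted_wrt (\<lambda>a b. b dvd a) (l d)" if "smith_normal_form M d" for d
    using that by (auto simp: smith_normal_form_def l_def intro: dvd_trans)
  have "l d = l d'"
  proof (rule divisor_chain_unique)
    show "(\<Prod>x\<leftarrow>l d. gcd x n) = (\<Prod>x\<leftarrow>l d'. gcd x n)" if "n > 0" for n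
      using c[OF d(1) that] c[OF d'(1) that] by simp
  qed (use d d' s in \<open>auto simp: l_def\<close>)
  then show ?thesis by (simp add: l_def vec_eq_iff forall_5)
qed

section \<open>Double cosets\<close>

lemma abs_nat_mult: "x * y = (int m)\<^sup>2 \<Longrightarrow> nat \<bar>x\<bar> * nat \<bar>y\<bar> = m\<^sup>2"
  by (metis abs_of_nat nat_abs_mult_distrib nat_int of_nat_power)

lemma diagonal_representative:
  assumes sf: "squarefree N" and m: "m > 0" "over_m m M \<in> SO0 N"
  shows "\<exists>A\<in>Gamma_int N. \<exists>B\<in>Gamma_int N. \<exists>\<alpha> \<alpha>' \<delta>' \<delta> :: nat.
    0 < \<alpha> \<and> 0 < \<alpha>' \<and> 0 < \<delta>' \<and> 0 < \<delta> \<and> \<alpha> * \<delta> = m\<^sup>2 \<and> \<alpha>' * \<delta>' = m\<^sup>2 \<and>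
    \<alpha> dvd \<alpha>' \<and> \<alpha>' dvd m \<and> m dvd \<delta>' \<and> \<delta>' dvd \<delta> \<and>
    A ** M ** B = diag_mat (vector [\<alpha>, \<alpha>', m, \<delta>', \<delta>])"
proof -
  have N: "N > 0" by (rule squarefree_nat_pos[OF sf])
  obtain A1 B1 where A1: "A1 \<in> Gamma_int N" "B1 \<in> Gamma_int N" and blk: "block_diagonal (A1 ** M ** B1)"
    and c0: "(A1 ** M ** B1)$1$1 \<noteq> 0" and dvd: "\<And>i j. (A1 ** M ** B1)$1$1 dvd (A1 ** M ** B1)$i$j"
    using first_pivot[OF assms] by blast
  define M1 where "M1 = A1 ** M ** B1"
  have M1: "over_m m M1 \<in> SO0 N" unfolding M1_def by (rule over_m_SO0_mult[OF m(2) A1])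
  define c where "c = M1$1$1"
  define d where "d = M1$5$5"
  obtain A2 B2 c' p d' where A2: "A2 \<in> Gamma_levi N" "B2 \<in> Gamma_levi N" and c': "c' \<noteq> 0" "c' * d' = (int m)\<^sup>2"
    and p: "p\<^sup>2 = (int m)\<^sup>2" "c' dvd p"
    and Z0: "A2 ** M1 ** B2 = vector [vector [c, 0, 0, 0, 0], vector [0, c', 0, 0, 0], vector [0, 0, p, 0, 0],
      vector [0, 0, 0, d', 0], vector [0, 0, 0, 0, d]]"
    using second_pivot[OF sf m(1) M1 blk[folded M1_def]] unfolding c_def d_def by blast
  have A2': "A2 \<in> Gamma_int N" "B2 \<in> Gamma_int N" using A2 by (auto simp: Gamma_levi_def)
  define Z where "Z = A2 ** M1 ** B2"
  have Z: "Z = vector [vector [c, 0, 0, 0, 0], vector [0, c', 0, 0, 0], vector [0, 0, p, 0, 0],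
      vector [0, 0, 0, d', 0], vector [0, 0, 0, 0, d]]"
    unfolding Z_def by (rule Z0)
  have Zdiag: "Z$1$1 = c" "Z$2$2 = c'" "Z$3$3 = p" "Z$4$4 = d'" "Z$5$5 = d"
    by (simp_all add: Z vector_5)
  have Zoff: "Z$i$j = 0" if "i \<noteq> j" for i j
    using that exhaust_5[of i] exhaust_5[of j] by (auto simp: Z vector_5)
  have ZSO: "over_m m Z \<in> SO0 N" unfolding Z_def by (rule over_m_SO0_mult[OF M1 A2'])
  then have ZSO': "over_m m Z \<in> SO N" using SO0_subset_SO by blast
  have cc': "c dvd c'"
  proof -
    have "c dvd (A2 ** M1 ** B2)$2$2"
      by (rule dvd_matrix_mult) (use dvd in \<open>simp add: c_def M1_def\<close>)
    then show ?thesis by (simp add: Z0 vector_5)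
  qed
  have cd: "c * d = (int m)\<^sup>2"
    using over_m_form[OF m(1) ZSO', of 1 5] by (simp add: transform_form_mat form_mat_nth Zdiag Zoff)
  have c: "c \<noteq> 0" using c0 by (simp add: c_def M1_def)
  have X: "over_m m Z $ i $ j = real_of_int (Z$i$j) / real m" for i j
    by (simp add: over_m_def real_matrix_nth)
  \<comment> \<open>The form gives only \<open>p^2 = m^2\<close>; determinant 1 together with
    \<open>c * d = c' * d' = m^2\<close> fixes the sign.\<close>
  have "p = int m"
  proof -
    have "det (over_m m Z) = (\<Prod>i\<in>UNIV. over_m m Z $ i $ i)"
    proof (rule det_diagonal)
      fix i j :: 5 assume "i \<noteq> j"
      then show "over_m m Z $ i $ j = 0" by (simp add: X Zoff)
    qed
    also have "(UNIV :: 5 set) = {1, 2, 3, 4, 5}" using exhaust_5 by auto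
    finally have "real_of_int c * real_of_int c' * real_of_int p * real_of_int d' * real_of_int d = real m ^ 5"
      using ZSO' m(1) by (simp add: SO_iff X Zdiag field_simps eval_nat_numeral)
    then have "real_of_int (c * d * (c' * d') * p) = real_of_int (int m ^ 5)"
      by (simp add: ac_simps)
    then have "c * d * (c' * d') * p = int m ^ 5" by (simp only: of_int_eq_iff)
    then have "(int m) ^ 4 * p = (int m) ^ 4 * int m" by (simp add: cd c'(2) eval_nat_numeral ac_simps)
    then show ?thesis using m(1) by simp
  qed
  \<comment> \<open>On a diagonal matrix \<open>positive_block\<close> is
    \<open>(c + d) * (c' + d')\<close> up to a positive factor, and \<open>c\<close>,
    \<open>d\<close> share a sign, as do \<open>c'\<close>, \<open>d'\<close>.\<close>
  have sgn: "c * c' > 0"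
  proof -
    have pos: "c * d > 0" "c' * d' > 0" using cd c'(2) m(1) by simp_all
    have "positive_block (over_m m Z) > 0" by (rule positive_block_SO0[OF ZSO])
    then have "real_of_int ((c + d) * (c' + d')) > 0"
      using m(1) by (simp add: positive_block_def X Zdiag Zoff zero_less_mult_iff zero_less_divide_iff
          divide_less_0_iff flip: add_divide_distrib)
    then have "(c + d) * (c' + d') > 0" by linarith
    then show ?thesis using pos by (auto simp: zero_less_mult_iff)
  qed
  \<comment> \<open>The square of \<open>row_swap\<close> is \<open>diag(-1, -1, 1, -1, -1)\<close>,
    which removes the one remaining common sign.\<close>
  define F :: "int^5^5" where "F = (if c < 0 then row_swap ** row_swap else mat 1)"
  have F: "F \<in> Gamma_int N"
    using Gamma_int_one swaps_Gamma_int[OF N] by (auto simp: F_def intro: Gamma_int_mult)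
  have FZ: "F ** Z = diag_mat (vector [nat \<bar>c\<bar>, nat \<bar>c'\<bar>, m, nat \<bar>d'\<bar>, nat \<bar>d\<bar>])"
  proof -
    have "(c < 0 \<and> c' < 0 \<and> d' < 0 \<and> d < 0) \<or> (c > 0 \<and> c' > 0 \<and> d' > 0 \<and> d > 0)"
      using sgn cd c'(2) m(1) by (smt (verit) zero_less_mult_iff of_nat_0_less_iff zero_less_power)
    then show ?thesis
      by (auto simp: F_def Z diag_mat_def matrix_5_simps row_swap_def \<open>p = int m\<close>)
  qed
  have "F ** Z = (F ** (A2 ** A1)) ** M ** (B1 ** B2)"
    by (simp add: Z_def M1_def matrix_mul_assoc)
  then have rep: "(F ** (A2 ** A1)) ** M ** (B1 ** B2) = diag_mat (vector [nat \<bar>c\<bar>, nat \<bar>c'\<bar>, m, nat \<bar>d'\<bar>, nat \<bar>d\<bar>])"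
    using FZ by simp
  have md': "int m dvd d'"
  proof -
    obtain k where k: "int m = c' * k" using p(2) \<open>p = int m\<close> by auto
    then have "c' * d' = c' * (k * int m)" using c'(2) by (simp add: power2_eq_square)
    then show ?thesis using c'(1) by simp
  qed
  have d'd: "d' dvd d"
  proof -
    obtain k where k: "c' = c * k" using cc' by auto
    then have "c * d = c * (k * d')" using c'(2) cd by simp
    then show ?thesis using c by simp
  qed
  have d0: "d \<noteq> 0" "d' \<noteq> 0" using cd c'(2) m(1) by auto
  have c'm: "c' dvd int m" using p(2) \<open>p = int m\<close> by simp
  have nat_dvd: "nat \<bar>x\<bar> dvd nat \<bar>y\<bar>" if "x dvd y" for x y :: int
    using that by (simp add: nat_abs_dvd_iff)
  have "0 < nat \<bar>c\<bar> \<and> 0 < nat \<bar>c'\<bar> \<and> 0 < nat \<bar>d'\<bar> \<and> 0 < nat \<bar>d\<bar> \<and>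
      nat \<bar>c\<bar> * nat \<bar>d\<bar> = m\<^sup>2 \<and> nat \<bar>c'\<bar> * nat \<bar>d'\<bar> = m\<^sup>2 \<and>
      nat \<bar>c\<bar> dvd nat \<bar>c'\<bar> \<and> nat \<bar>c'\<bar> dvd m \<and> m dvd nat \<bar>d'\<bar> \<and> nat \<bar>d'\<bar> dvd nat \<bar>d\<bar>"
  proof (intro conjI)
    show "0 < nat \<bar>c\<bar>" "0 < nat \<bar>c'\<bar>" "0 < nat \<bar>d'\<bar>" "0 < nat \<bar>d\<bar>"
      using c c'(1) d0 by simp_all
    show "nat \<bar>c'\<bar> dvd m" "m dvd nat \<bar>d'\<bar>"
      using nat_dvd[OF c'm] nat_dvd[OF md'] by (simp_all only: abs_of_nat nat_int)
  qed (rule abs_nat_mult[OF cd] abs_nat_mult[OF c'(2)] nat_dvd[OF cc'] nat_dvd[OF d'd])+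
  moreover have "F ** (A2 ** A1) \<in> Gamma_int N" "B1 ** B2 \<in> Gamma_int N"
    by (intro Gamma_int_mult F A1 A2')+
  ultimately show ?thesis using rep by blast
qed

lemma Gamma_hat_iff: "x \<in> Gamma_hat N \<longleftrightarrow> (\<exists>A\<in>Gamma_int N. x = real_matrix A)"
proof
  assume x: "x \<in> Gamma_hat N"
  have "x = real_matrix (\<chi> i j. \<lfloor>x$i$j\<rfloor>)"
    using x by (simp add: Gamma_hat_def vec_eq_iff real_matrix_nth)
  then show "\<exists>A\<in>Gamma_int N. x = real_matrix A"
    using x by (metis (mono_tags, lifting) Gamma_hat_def Gamma_int_def IntD1 mem_Collect_eq)
next
  assume "\<exists>A\<in>Gamma_int N. x = real_matrix A"
  then show "x \<in> Gamma_hat N"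
    by (auto simp: Gamma_hat_def Gamma_int_def real_matrix_nth)
qed

lemma double_coset_over_m:
  "x \<in> double_coset N (over_m m M) \<longleftrightarrow> (\<exists>A\<in>Gamma_int N. \<exists>B\<in>Gamma_int N. x = over_m m (A ** M ** B))"
  by (auto simp: double_coset_def Gamma_hat_iff over_m_mult)

lemma over_m_inject: "m > 0 \<Longrightarrow> over_m m A = over_m m B \<longleftrightarrow> A = B"
  by (simp add: over_m_def real_matrix_inject)

lemma double_coset_eq:
  assumes sf: "squarefree N" and "x \<in> double_coset N (over_m m M)"
  shows "double_coset N x = double_coset N (over_m m M)"
proof -
  obtain A B where A: "A \<in> Gamma_int N" and B: "B \<in> Gamma_int N" and x: "x = over_m m (A ** M ** B)"
    using assms(2) by (auto simp: double_coset_over_m)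
  note iA = Gamma_int_inverse[OF sf A] and iB = Gamma_int_inverse[OF sf B]
  show ?thesis
  proof (intro equalityI subsetI)
    fix y assume "y \<in> double_coset N x"
    then obtain C D where "C \<in> Gamma_int N" "D \<in> Gamma_int N" "y = over_m m (C ** (A ** M ** B) ** D)"
      unfolding x double_coset_over_m by blast
    then have "C ** A \<in> Gamma_int N" "B ** D \<in> Gamma_int N" "y = over_m m ((C ** A) ** M ** (B ** D))"
      using A B by (simp_all add: Gamma_int_mult matrix_mul_assoc)
    then show "y \<in> double_coset N (over_m m M)" unfolding double_coset_over_m by blast
  next
    fix y assume "y \<in> double_coset N (over_m m M)"
    then obtain C D where CD: "C \<in> Gamma_int N" "D \<in> Gamma_int N" "y = over_m m (C ** M ** D)"
      unfolding double_coset_over_m by blast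
    have "C ** adjoint_mat N A ** (A ** M ** B) ** (adjoint_mat N B ** D)
        = C ** (adjoint_mat N A ** A) ** M ** (B ** adjoint_mat N B) ** D"
      by (simp add: matrix_mul_assoc)
    also have "\<dots> = C ** M ** D" by (simp add: iA iB)
    finally have "y = over_m m (C ** adjoint_mat N A ** (A ** M ** B) ** (adjoint_mat N B ** D))"
      using CD(3) by simp
    moreover have "C ** adjoint_mat N A \<in> Gamma_int N" "adjoint_mat N B ** D \<in> Gamma_int N"
      using CD iA iB by (simp_all add: Gamma_int_mult)
    ultimately show "y \<in> double_coset N x" unfolding x double_coset_over_m by blast
  qed
qed

text \<open>The two group elements linking \<open>M\<close> to the representative are invertible
  over the integers, so its numerators already form a Smith normal form of \<open>M\<close>.\<close>

lemma elementary_rep_smith: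
  assumes sf: "squarefree N" and m: "m > 0" and D: "D \<in> double_coset N (over_m m M)" "elementary_rep m D"
  obtains d where "D = over_m m (diag_mat d)" "d $ 3 = m" "\<forall>i. 0 < d $ i" "smith_normal_form M d"
proof -
  obtain \<alpha> \<alpha>' \<delta>' \<delta> :: nat where e: "0 < \<alpha>" "0 < \<alpha>'" "0 < \<delta>'" "0 < \<delta>"
    "\<alpha> dvd \<alpha>'" "\<alpha>' dvd m" "m dvd \<delta>'" "\<delta>' dvd \<delta>" "D = over_m m (diag_mat (vector [\<alpha>, \<alpha>', m, \<delta>', \<delta>]))"
    using D(2) by (auto simp: elementary_rep_def)
  obtain A B where A: "A \<in> Gamma_int N" and B: "B \<in> Gamma_int N" and x: "D = over_m m (A ** M ** B)"
    using D(1) by (auto simp: double_coset_over_m)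
  have "A ** M ** B = diag_mat (vector [\<alpha>, \<alpha>', m, \<delta>', \<delta>])"
    using x e(9) over_m_inject[OF m] by simp
  moreover have "invertible A" "invertible B"
    using Gamma_int_inverse[OF sf A] Gamma_int_inverse[OF sf B] by (auto simp: invertible_def)
  ultimately have "smith_normal_form M (vector [\<alpha>, \<alpha>', m, \<delta>', \<delta>])"
    using e by (auto simp: smith_normal_form_def vector_5)
  then show thesis using that[of "vector [\<alpha>, \<alpha>', m, \<delta>', \<delta>]"] e m by (simp add: forall_5 vector_5)
qed

theorem theorem1:
  fixes N :: nat
  assumes "squarefree N"
  shows "(\<forall>m M. 0 < m \<and> over_m m M \<in> G_hat N \<longrightarrow>
            (\<exists>!D. D \<in> double_coset N (over_m m M) \<and> elementary_rep m D)) \<and>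
         (\<forall>m M m' M'. 0 < m \<and> over_m m M \<in> G_hat N \<and>
            0 < m' \<and> over_m m' M' \<in> G_hat N \<and>
            smith_invariants M = smith_invariants M' \<longrightarrow>
            double_coset N (over_m m M) = double_coset N (over_m m' M'))"
proof -
  have ex: "\<exists>D. D \<in> double_coset N (over_m m M) \<and> elementary_rep m D"
    if "0 < m" "over_m m M \<in> G_hat N" for m M
  proof -
    have "over_m m M \<in> SO0 N" using that(2) by (simp add: G_hat_def)
    from diagonal_representative[OF assms that(1) this]
    obtain A B and \<alpha> \<alpha>' \<delta>' \<delta> :: nat where AB: "A \<in> Gamma_int N" "B \<in> Gamma_int N"
      and e: "0 < \<alpha>" "0 < \<alpha>'" "0 < \<delta>'" "0 < \<delta>" "\<alpha> * \<delta> = m\<^sup>2" "\<alpha>' * \<delta>' = m\<^sup>2"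
        "\<alpha> dvd \<alpha>'" "\<alpha>' dvd m" "m dvd \<delta>'" "\<delta>' dvd \<delta>"
        "A ** M ** B = diag_mat (vector [\<alpha>, \<alpha>', m, \<delta>', \<delta>])"
      by blast
    have "elementary_rep m (over_m m (A ** M ** B))"
      unfolding elementary_rep_def e(11) using e(1-10) by blast
    moreover have "over_m m (A ** M ** B) \<in> double_coset N (over_m m M)"
      unfolding double_coset_over_m using AB by blast
    ultimately show ?thesis by blast
  qed
  have smith: "smith_invariants M = d" if "smith_normal_form M d" "\<forall>i. 0 < d$i" for M d
    unfolding smith_invariants_def
    by (rule the_equality, rule that(1)) (rule smith_normal_form_unique[OF that, symmetric])
  show ?thesis
  proof (intro conjI allI impI; elim conjE)
    fix m M assume m: "0 < m" and M: "over_m m M \<in> G_hat N"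
    show "\<exists>!D. D \<in> double_coset N (over_m m M) \<and> elementary_rep m D"
    proof (rule ex_ex1I[OF ex[OF m M]])
      fix D D' assume "D \<in> double_coset N (over_m m M) \<and> elementary_rep m D"
        "D' \<in> double_coset N (over_m m M) \<and> elementary_rep m D'"
      then show "D = D'"
        by (metis elementary_rep_smith[OF assms m] smith)
    qed
  next
    fix m M m' M' assume m: "0 < m" and M: "over_m m M \<in> G_hat N"
      and m': "0 < m'" and M': "over_m m' M' \<in> G_hat N" and inv: "smith_invariants M = smith_invariants M'"
    obtain D where D: "D \<in> double_coset N (over_m m M)" "elementary_rep m D" using ex[OF m M] by blast
    obtain D' where D': "D' \<in> double_coset N (over_m m' M')" "elementary_rep m' D'" using ex[OF m' M'] by blast
    obtain d where d: "D = over_m m (diag_mat d)" "d $ 3 = m" "\<forall>i. 0 < d $ i" "smith_normal_form M d"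
      using elementary_rep_smith[OF assms m D] .
    obtain d' where d': "D' = over_m m' (diag_mat d')" "d' $ 3 = m'" "\<forall>i. 0 < d' $ i" "smith_normal_form M' d'"
      using elementary_rep_smith[OF assms m' D'] .
    have "d = d'" using smith d d' inv by metis
    \<comment> \<open>The third invariant is the denominator, so equal invariants also give
      \<open>m = m'\<close>.\<close>
    then have "D = D'" using d d' by simp
    then show "double_coset N (over_m m M) = double_coset N (over_m m' M')"
      using double_coset_eq[OF assms D(1)] double_coset_eq[OF assms D'(1)] by simp
  qed
qed

end
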